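(* Let $F:X\to X$ be a hemicontinuous and monotone operator, let $x^\dagger\in X$ satisfy $F(x^\dagger)=y$, let $\bar x\in X$, and let $\mathcal{M}\subset X$ be such that, for some constant $\beta\in[0,1)$ and some index function $\varphi$, $$\langle x^\dagger-\bar x,\,x^\dagger-x\rangle\le\beta\|x-x^\dagger\|^2+\varphi\big(\langle F(x)-F(x^\dagger),\,x-x^\dagger\rangle\big)\qquad\text{for all }x\in\mathcal{M}.$$ Let $\Psi$ be an index function associated with $\varphi$ as described in the context, and put $\Theta(\alpha):=\alpha^2\Psi(\alpha)$. Moreover, let $\alpha>0$ be chosen such that all regularized solutions $x_\alpha^\delta$ belong to $\mathcal{M}$ for sufficiently small $\delta>0$. Then, for such $\delta>0$, $$\|x_\alpha^\delta-x^\dagger\|^2\le\frac{1}{(1-\beta)^2}\,\frac{\delta^2}{\alpha^2}+\frac{2}{1-\beta}\,\Psi(\alpha).$$ For the a priori choice $\alpha_{apri}=\alpha(\delta):=\Theta^{-1}(\delta^2)$ this yields the convergence rate $$\|x_{\alpha_{apri}}^\delta-x^\dagger\|=O\!\left(\frac{\delta}{\Theta^{-1}(\delta^2)}\right)=O\!\left(\sqrt{\Psi(\Theta^{-1}(\delta^2))}\right)\qquad\text{as }\delta\to0 .$$ The best possible rate occurs for $\varphi(t)\sim\sqrt t$ and $\Psi(t)\sim t$, namely $$\|x_{\alpha_{apri}}^\delta-x^\dagger\|=O(\delta^{1/3})\qquad\text{if }\alpha(\delta)\sim\delta^{2/3};$$ here "best possible" means that whenever $\liminf_{t\to+0}\varphi(t)/\sqrt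 t>0$ there is a constant $c_3>0$ with $\delta/\Theta^{-1}(\delta^2)\ge c_3\,\delta^{1/3}$ for all sufficiently small $\delta>0$. The same convergence rate is also obtained with the Lepskii (balancing) principle, i.e. for the a posteriori choice $\alpha_{Lep}=\alpha(\delta,y^\delta)$ defined in the context, $$\|x_{\alpha_{Lep}}^\delta-x^\dagger\|=O\!\left(\frac{\delta}{\Theta^{-1}(\delta^2)}\right)\qquad\text{as }\delta\to0 .$$
   Context: $X$ is an infinite dimensional separable real Hilbert space with norm $\|\cdot\|$ and inner product $\langle\cdot,\cdot\rangle$. $F:X\to X$ is monotone if $\langle F(x)-F(\tilde x),x-\tilde x\rangle\ge 0$ for all $x,\tilde x\in X$; hemicontinuous means that for all $x,h,z\in X$ the map $t\mapsto\langle F(x+th),z\rangle$ is continuous on $\mathbb{R}$. For $\alpha>0$, $\delta>0$ and noisy data $y^\delta\in X$ with $\|y-y^\delta\|\le\delta$, the (Lavrentiev) regularized solution $x_\alpha^\delta\in X$ is the unique solution (it exists by the Browder-Minty theorem) of $$F(x_\alpha^\delta)+\alpha(x_\alpha^\delta-\bar x)=y^\delta .$$ An index function is a function $\theta:(0,\infty)\to(0,\infty)$ that is continuous, strictly increasing and satisfies $\lim_{t\to+0}\theta(t)=0$; it is extended by $\theta(0)=0$. The notation $a\sim b$ means that the quotient is bounded above and below by positive constants as the argument tends to $0$. The parameter $\alpha$ may depend on $\delta$ (and $y^\delta$); in the rate statements the requirement that the regularized solutions involved belong to $\mathcal{M}$ for sufficiently small $\delta$ is part of the assumptions. Construction of $\Psi$: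 let $f$ be an index function whose antiderivative $\tilde f(s):=\int_0^s f(t)\,dt$ satisfies $\tilde f(\varphi(s))\le s$ for $s>0$, let $G$ be a function with $G(\alpha)\ge\int_0^\alpha f^{-1}(\tau)\,d\tau$ (with $f^{-1}$ the inverse function of $f$; all values of $\alpha$ considered are understood to be such that this is defined), and set $\Psi(\alpha):=G(\alpha)/\alpha$, where $f$ and $G$ are such that $\Psi$ is an index function. Lepskii principle: fix $0<q<1$, put $$\Sigma(\alpha,\delta):=\frac{\sqrt{3-2\beta}}{1-\beta}\,\frac{\delta}{\alpha},\qquad \Delta_q:=\{\alpha_j:\ \alpha_j=\alpha_0/q^j,\ j=0,1,2,\dots\},$$ with $\alpha_0>0$ sufficiently small such that $\|x_{\alpha_0}^\delta-x^\dagger\|\le\Sigma(\alpha_0,\delta)$, and set $$\alpha_{Lep}:=\max\{\alpha\in\Delta_q:\ \|x_{\alpha'}^\delta-x_\alpha^\delta\|\le 2\,\Sigma(\alpha',\delta)\ \text{ for all }\alpha'\in\Delta_q\cap[\alpha_0,\alpha]\}.$$ *)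

theory Defs
  imports "HOL-Analysis.Analysis" "HOL-Library.Landau_Symbols"
begin

definition monotone_operator :: "('a::real_inner \<Rightarrow> 'a) \<Rightarrow> bool" where
  "monotone_operator F \<longleftrightarrow> (\<forall>x x'. inner (F x - F x') (x - x') \<ge> 0)"

definition hemicontinuous :: "('a::real_inner \<Rightarrow> 'a) \<Rightarrow> bool" where
  "hemicontinuous F \<longleftrightarrow>
     (\<forall>x h z. continuous_on UNIV (\<lambda>t::real. inner (F (x + t *\<^sub>R h)) z))"

text \<open>For \<open>\<alpha> > 0\<close> and a hemicontinuous monotone operator on a real Hilbert space, the
  description below is proper by the Browder--Minty theorem.\<close>

definition lavrentiev :: "('a::real_inner \<Rightarrow> 'a) \<Rightarrow> 'a \<Rightarrow> real \<Rightarrow> 'a \<Rightarrow> 'a" where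
  "lavrentiev F xbar \<alpha> yd = (THE x. F x + \<alpha> *\<^sub>R (x - xbar) = yd)"

text \<open>The limit \<open>\<delta> \<rightarrow> 0+\<close> taken uniformly over all data with noise level \<open>\<delta>\<close>:
  a property holds eventually iff there is \<open>\<delta>0 > 0\<close> such that it holds for all \<open>(\<delta>, yd)\<close> with
  \<open>0 < \<delta> < \<delta>0\<close> and \<open>norm (y - yd) \<le> \<delta>\<close>.\<close>

definition noise_to_0 :: "'a::real_normed_vector \<Rightarrow> (real \<times> 'a) filter" where
  "noise_to_0 y =
     inf (filtercomap fst (at_right 0)) (principal {(\<delta>, yd). norm (y - yd) \<le> \<delta>})"

text \<open>Only the values on \<open>[0, \<infinity>)\<close> matter; the extension by \<open>0\<close> at \<open>0\<close> is built in.\<close>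

definition index_function :: "(real \<Rightarrow> real) \<Rightarrow> bool" where
  "index_function \<theta> \<longleftrightarrow>
     continuous_on {0<..} \<theta> \<and> strict_mono_on {0<..} \<theta> \<and> (\<forall>t>0. \<theta> t > 0) \<and>
     (\<theta> \<longlongrightarrow> 0) (at_right 0) \<and> \<theta> 0 = 0"

definition index_inv :: "(real \<Rightarrow> real) \<Rightarrow> real \<Rightarrow> real" where
  "index_inv \<theta> = inv_into {0..} \<theta>"

text \<open>An index function may be bounded, so that its inverse is only defined on a bounded
  interval. The following says that the integral of \<open>f\<^sup>-\<^sup>1\<close> over \<open>(0, \<alpha>)\<close> is defined (and finite);
  the case \<open>\<alpha> = sup f\<close> is included if the integral converges.\<close>

definition inverse_integral_defined :: "(real \<Rightarrow> real) \<Rightarrow> real \<Rightarrow> bool" where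
  "inverse_integral_defined f \<alpha> \<longleftrightarrow>
     {0<..<\<alpha>} \<subseteq> f ` {0<..} \<and> index_inv f integrable_on {0..\<alpha>}"

definition Psi :: "(real \<Rightarrow> real) \<Rightarrow> real \<Rightarrow> real" where
  "Psi G \<alpha> = G \<alpha> / \<alpha>"

definition Psi_construction ::
    "(real \<Rightarrow> real) \<Rightarrow> (real \<Rightarrow> real) \<Rightarrow> (real \<Rightarrow> real) \<Rightarrow> bool" where
  "Psi_construction \<phi> f G \<longleftrightarrow>
     index_function f \<and>
     (\<forall>s>0. integral {0..\<phi> s} f \<le> s) \<and>
     (\<forall>\<alpha>>0. inverse_integral_defined f \<alpha> \<longrightarrow> integral {0..\<alpha>} (index_inv f) \<le> G \<alpha>) \<and>
     index_function (Psi G)"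

definition Theta :: "(real \<Rightarrow> real) \<Rightarrow> real \<Rightarrow> real" where
  "Theta G \<alpha> = \<alpha>\<^sup>2 * Psi G \<alpha>"

definition alpha_apri :: "(real \<Rightarrow> real) \<Rightarrow> real \<Rightarrow> real" where
  "alpha_apri G \<delta> = index_inv (Theta G) (\<delta>\<^sup>2)"

definition Sigma_bound :: "real \<Rightarrow> real \<Rightarrow> real \<Rightarrow> real" where
  "Sigma_bound \<beta> \<alpha> \<delta> = sqrt (3 - 2 * \<beta>) / (1 - \<beta>) * (\<delta> / \<alpha>)"

definition lepskii_grid :: "real \<Rightarrow> real \<Rightarrow> real set" where
  "lepskii_grid q \<alpha>0 = {\<alpha>0 / q ^ j | j. True}"

definition lepskii_set ::
    "('a::real_inner \<Rightarrow> 'a) \<Rightarrow> 'a \<Rightarrow> real \<Rightarrow> real \<Rightarrow> real \<Rightarrow> real \<Rightarrow> 'a \<Rightarrow> real set" where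
  "lepskii_set F xbar \<beta> q \<alpha>0 \<delta> yd =
     {\<alpha> \<in> lepskii_grid q \<alpha>0.
        \<forall>\<alpha>' \<in> lepskii_grid q \<alpha>0 \<inter> {\<alpha>0..\<alpha>}.
          norm (lavrentiev F xbar \<alpha>' yd - lavrentiev F xbar \<alpha> yd) \<le> 2 * Sigma_bound \<beta> \<alpha>' \<delta>}"

text \<open>The grid is unbounded above, so for \<open>\<alpha>0 > 0\<close> and \<open>0 < q < 1\<close> the maximum exists iff
  the (nonempty) set is finite.\<close>

definition alpha_Lep ::
    "('a::real_inner \<Rightarrow> 'a) \<Rightarrow> 'a \<Rightarrow> real \<Rightarrow> real \<Rightarrow> real \<Rightarrow> real \<Rightarrow> 'a \<Rightarrow> real" where
  "alpha_Lep F xbar \<beta> q \<alpha>0 \<delta> yd = Max (lepskii_set F xbar \<beta> q \<alpha>0 \<delta> yd)"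

end

theory Submission
  imports Defs
begin

text \<open>Testing the regularized equation with the error \<open>x - xdag\<close> gives, with
  \<open>e = norm (x - xdag)\<close> and \<open>D = \<langle>F x - F xdag, x - xdag\<rangle>\<close>, the inequality
  \<open>D + \<alpha> (1 - \<beta>) e\<^sup>2 \<le> \<delta> e + \<alpha> \<phi> D\<close>. The function \<open>\<Psi>\<close> is made so that Young's inequality for \<open>f\<close>
  and its inverse yields \<open>\<alpha> \<phi> D \<le> D + \<alpha> \<Psi>(\<alpha>)\<close> (\<open>scaled_phi_le\<close>). So \<open>D\<close> cancels, and absorbing
  \<open>\<delta> e\<close> into \<open>e\<^sup>2\<close> gives the error estimate (\<open>lavrentiev_error_estimate\<close>).

  All of this needs the regularized equation to be solvable. That is the Browder--Minty theorem,
  proved here through the Fitzpatrick function, whose sum with half the squared norm is strongly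
  convex; its minimiser provides the solution (\<open>monotone_hemicontinuous_plus_id_zero\<close>).

  The a priori parameter solves \<open>\<delta>\<^sup>2 / \<alpha>\<^sup>2 = \<Psi>(\<alpha>)\<close>, so there both terms of the estimate
  coincide up to constants, and for smaller \<open>\<alpha>\<close> the noise term dominates. If \<open>\<Psi>\<close> is of linear order, this equation reads
  \<open>\<alpha>\<^sup>3 \<sim> \<delta>\<^sup>2\<close>. No better rate can come out when \<open>\<phi>\<close> is at least of the order of the square root, because
  the inequality \<open>\<alpha> \<phi> t \<le> t + \<alpha> \<Psi>(\<alpha>)\<close>, with \<open>t\<close> optimised, then forces \<open>\<Psi>\<close> to be at least linear
  (\<open>Psi_lower_bound\<close>).

  For the balancing principle, the last grid point before the a priori parameter passes the test,
  and its error is optimal up to the factor \<open>1/q\<close>. The selected parameter is at least as large, and the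
  test itself keeps its solution within twice the bound of that grid point (\<open>alpha_Lep_error\<close>).
  If \<open>xdag \<noteq> xbar\<close>, the maximum that defines it exists for small noise, since the regularized
  solutions for large parameters approach \<open>xbar\<close> and so stay away from \<open>xdag\<close>.\<close>

section \<open>Solvability of the regularized equation\<close>

text \<open>A convex function on a Hilbert space, given by its epigraph \<open>E\<close>, becomes strongly convex when
  the squared norm is added. Minimising sequences are then Cauchy by the parallelogram law, so
  completeness alone yields a minimum. The conclusion is the first-order condition at the
  minimiser: the negative of \<open>p\<close> is a subgradient there.\<close>

lemma quadratic_epigraph_minimiser:
  fixes E :: "('p::{real_inner,complete_space} \<times> real) set"
  assumes E: "closed E" "convex E" "E \<noteq> {}"
    and bound: "\<And>p r. (p, r) \<in> E \<Longrightarrow> c \<le> r + (norm p)\<^sup>2 / 2"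
  obtains p r where "(p, r) \<in> E"
    and "\<And>q s. (q, s) \<in> E \<Longrightarrow> r + inner p p \<le> s + inner p q"
proof -
  define J :: "'p \<times> real \<Rightarrow> real" where "J z = snd z + (norm (fst z))\<^sup>2 / 2" for z
  define m where "m = Inf (J ` E)"
  have bdd: "bdd_below (J ` E)"
    using bound by (intro bdd_belowI[of _ c]) (auto simp: J_def)
  have lower: "m \<le> J z" if "z \<in> E" for z
    unfolding m_def using bdd that by (simp add: cInf_lower)
  have "\<exists>z\<in>E. J z < m + 1 / real (Suc n)" for n
    using cInf_less_iff[of "J ` E" "m + 1 / real (Suc n)"] E(3) bdd by (auto simp: m_def)
  then obtain z where z: "\<And>n. z n \<in> E" "\<And>n. J (z n) < m + 1 / real (Suc n)"
    by metis
  have comb: "(1 - t) *\<^sub>R a + t *\<^sub>R b \<in> E" if "a \<in> E" "b \<in> E" "0 \<le> t" "t \<le> 1" for a b t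
    using E(2) that by (simp add: convex_alt)
  \<comment> \<open>The parallelogram law at the midpoint of \<open>a\<close> and \<open>b\<close>.\<close>
  have near: "(norm (fst a - fst b))\<^sup>2 \<le> 4 * ((J a - m) + (J b - m))"
    if "a \<in> E" "b \<in> E" for a b
  proof -
    have "m \<le> J ((1 - 1/2) *\<^sub>R a + (1/2) *\<^sub>R b)"
      using comb[OF that, of "1/2"] by (intro lower) simp
    also have "\<dots> = (J a + J b) / 2 - (norm (fst a - fst b))\<^sup>2 / 8"
      unfolding J_def power2_norm_eq_inner
      by (simp add: inner_add_left inner_add_right inner_diff_left inner_diff_right
          inner_commute field_simps)
    finally show ?thesis by (simp add: field_simps)
  qed
  have "Cauchy (\<lambda>n. fst (z n))"
    unfolding Cauchy_def
  proof (intro allI impI)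
    fix e :: real assume e: "e > 0"
    obtain N where N: "inverse (real (Suc N)) < e\<^sup>2 / 8"
      using reals_Archimedean[of "e\<^sup>2 / 8"] e by auto
    have gap: "J (z n) - m < e\<^sup>2 / 8" if "n \<ge> N" for n
    proof -
      have "1 / real (Suc n) \<le> 1 / real (Suc N)"
        using that by (simp add: frac_le)
      then show ?thesis using z(2)[of n] N by (simp add: inverse_eq_divide)
    qed
    show "\<exists>M. \<forall>k\<ge>M. \<forall>n\<ge>M. dist (fst (z k)) (fst (z n)) < e"
    proof (intro exI allI impI)
      fix k n assume kn: "k \<ge> N" "n \<ge> N"
      have "(norm (fst (z k) - fst (z n)))\<^sup>2 \<le> 4 * ((J (z k) - m) + (J (z n) - m))"
        by (rule near[OF z(1) z(1)])
      also have "\<dots> < 4 * (e\<^sup>2 / 8 + e\<^sup>2 / 8)"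
        by (intro mult_strict_left_mono add_strict_mono gap kn) simp
      finally have "(norm (fst (z k) - fst (z n)))\<^sup>2 < e\<^sup>2" by simp
      then show "dist (fst (z k)) (fst (z n)) < e"
        using e by (simp add: dist_norm power_less_imp_less_base)
    qed
  qed
  then obtain p where p: "(\<lambda>n. fst (z n)) \<longlonglongrightarrow> p"
    using Cauchy_convergent_iff convergent_def by blast
  define r where "r = m - (norm p)\<^sup>2 / 2"
  have Jlim: "(\<lambda>n. J (z n)) \<longlonglongrightarrow> m"
  proof (rule tendsto_sandwich[of "\<lambda>_. m" _ _ "\<lambda>n. m + 1 / real (Suc n)"])
    show "(\<lambda>n. m + 1 / real (Suc n)) \<longlonglongrightarrow> m"
      using tendsto_add[OF tendsto_const[of m] lim_inverse_n'[THEN LIMSEQ_Suc]] by simp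
  qed (use lower z in \<open>auto simp: less_imp_le\<close>)
  have "(\<lambda>n. J (z n) - (norm (fst (z n)))\<^sup>2 / 2) \<longlonglongrightarrow> r"
    unfolding r_def by (intro tendsto_intros Jlim p) auto
  then have "(\<lambda>n. snd (z n)) \<longlonglongrightarrow> r" by (simp add: J_def)
  from tendsto_Pair[OF p this] have "z \<longlonglongrightarrow> (p, r)" by simp
  then have pr: "(p, r) \<in> E"
    using E(1) z(1) closed_sequentially by blast
  moreover have "r + inner p p \<le> s + inner p q" if qs: "(q, s) \<in> E" for q s
  proof (rule ccontr)
    define d where "d = s + inner p q - (r + inner p p)"
    assume "\<not> ?thesis"
    then have d: "d < 0" by (simp add: d_def)
    \<comment> \<open>The minimum is compared with the values on the segment towards \<open>(q, s)\<close>, near \<open>t = 0\<close>.\<close>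
    have slope: "0 \<le> d + t * (inner (q - p) (q - p) / 2)" if t: "0 < t" "t \<le> 1" for t
    proof -
      have "m \<le> J ((1 - t) *\<^sub>R (p, r) + t *\<^sub>R (q, s))"
        using comb[OF pr qs, of t] t by (intro lower) simp
      also have "\<dots> = m + t * (d + t * (inner (q - p) (q - p) / 2))"
        unfolding J_def r_def d_def power2_norm_eq_inner
        by (simp add: inner_add_left inner_add_right inner_diff_left inner_diff_right
            inner_commute field_simps)
      finally show ?thesis using t by (simp add: zero_le_mult_iff)
    qed
    have "((\<lambda>t. d + t * (inner (q - p) (q - p) / 2)) \<longlongrightarrow> d + 0 * (inner (q - p) (q - p) / 2))
        (at_right 0)"
      by (intro tendsto_intros)
    moreover have "\<forall>\<^sub>F t in at_right 0. 0 \<le> d + t * (inner (q - p) (q - p) / 2)"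
      using slope by (intro eventually_at_rightI[of 0 1]) auto
    ultimately have "0 \<le> d + 0 * (inner (q - p) (q - p) / 2)"
      by (intro tendsto_lowerbound) auto
    then show False using d by simp
  qed
  ultimately show ?thesis by (rule that)
qed

text \<open>For monotone \<open>F\<close> this says that the graph is maximal monotone. Testing with \<open>y = a + t z\<close> in the
  direction \<open>z = b - F a\<close> and letting \<open>t\<close> decrease to 0 leaves the negative square of
  \<open>norm z\<close> on the side that should be nonnegative.\<close>

lemma eq_if_monotonically_related:
  assumes F: "hemicontinuous F"
    and related: "\<And>y. inner (F y - b) (y - a) \<ge> 0"
  shows "F a = b"
proof -
  define z where "z = b - F a"
  have "isCont (\<lambda>t::real. inner (F (a + t *\<^sub>R z)) z) 0"
    using F by (simp add: hemicontinuous_def continuous_on_eq_continuous_at)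
  then have "((\<lambda>t::real. inner (F (a + t *\<^sub>R z)) z) \<longlongrightarrow> inner (F a) z) (at_right 0)"
    by (auto simp: isCont_def intro: filterlim_at_within_not_equal tendsto_within_subset
        dest: tendsto_within_subset[OF _ subset_UNIV])
  moreover have "\<forall>\<^sub>F t in at_right (0::real). inner b z \<le> inner (F (a + t *\<^sub>R z)) z"
  proof (intro eventually_at_rightI[of 0 1])
    fix t :: real assume "t \<in> {0<..<1}"
    then show "inner b z \<le> inner (F (a + t *\<^sub>R z)) z"
      using related[of "a + t *\<^sub>R z"] by (simp add: inner_diff_left zero_le_mult_iff)
  qed auto
  ultimately have "inner b z \<le> inner (F a) z"
    by (intro tendsto_lowerbound) auto
  then have "inner z z \<le> 0" by (simp add: z_def inner_diff_left)
  then have "z = 0" by (metis inner_gt_zero_iff not_le)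
  then show ?thesis by (simp add: z_def)
qed

text \<open>Minty's surjectivity theorem, by the argument of Simons and Zalinescu. The Fitzpatrick function
  \<open>h (x, u) = sup y. \<langle>x, F y\<rangle> + \<langle>y, u\<rangle> - \<langle>y, F y\<rangle>\<close> is convex and lower semicontinuous, lies above
  \<open>\<langle>x, u\<rangle>\<close> by maximality, and equals \<open>\<langle>y, F y\<rangle>\<close> at the graph point \<open>(y, F y)\<close>. The first-order
  condition for the minimum of \<open>h\<close> plus half the squared norm, evaluated at all graph points, says
  that \<open>(-u, -x)\<close> is monotonically related to the graph, hence on it; then \<open>u = -x\<close>. The supremum may
  be infinite, so the proof works with the epigraph \<open>E\<close> of \<open>h\<close>.\<close>

lemma monotone_hemicontinuous_plus_id_zero:
  fixes F :: "'a::{real_inner,complete_space} \<Rightarrow> 'a"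
  assumes F: "hemicontinuous F" "monotone_operator F"
  obtains x where "F x + x = 0"
proof -
  define E where
    "E = {((x, u), r) | x u r. \<forall>y. inner x (F y) + inner y u - inner y (F y) \<le> r}"
  have E_iff: "((x, u), r) \<in> E \<longleftrightarrow> (\<forall>y. inner x (F y) + inner y u - inner y (F y) \<le> r)" for x u r
    by (simp add: E_def)
  have "E = (\<Inter>y. {z. inner (fst (fst z)) (F y) + inner y (snd (fst z)) - inner y (F y) \<le> snd z})"
    by (auto simp: E_def)
  moreover have "closed {z :: ('a \<times> 'a) \<times> real.
      inner (fst (fst z)) (F y) + inner y (snd (fst z)) - inner y (F y) \<le> snd z}" for y
    by (intro closed_Collect_le continuous_intros)
  moreover have "convex {z :: ('a \<times> 'a) \<times> real.
      inner (fst (fst z)) (F y) + inner y (snd (fst z)) - inner y (F y) \<le> snd z}" for y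
  proof (rule convexI)
    fix a b :: "('a \<times> 'a) \<times> real" and u v :: real
    let ?L = "\<lambda>z :: ('a \<times> 'a) \<times> real. inner (fst (fst z)) (F y) + inner y (snd (fst z)) - snd z"
    assume "a \<in> {z. inner (fst (fst z)) (F y) + inner y (snd (fst z)) - inner y (F y) \<le> snd z}"
      "b \<in> {z. inner (fst (fst z)) (F y) + inner y (snd (fst z)) - inner y (F y) \<le> snd z}"
      and uv: "0 \<le> u" "0 \<le> v" "u + v = 1"
    then have "?L a \<le> inner y (F y)" "?L b \<le> inner y (F y)" by auto
    then have "u * ?L a + v * ?L b \<le> inner y (F y)"
      using uv by (intro convex_bound_le) auto
    then show "u *\<^sub>R a + v *\<^sub>R b
        \<in> {z. inner (fst (fst z)) (F y) + inner y (snd (fst z)) - inner y (F y) \<le> snd z}"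
      by (simp add: inner_add_left inner_add_right algebra_simps)
  qed
  ultimately have cc: "closed E" "convex E"
    by (auto intro: closed_INT convex_INT)
  have graph: "((y, F y), inner y (F y)) \<in> E" for y
    unfolding E_iff
  proof
    fix y'
    have "inner (F y - F y') (y - y') \<ge> 0" using F(2) by (simp add: monotone_operator_def)
    then show "inner y (F y') + inner y' (F y) - inner y' (F y') \<le> inner y (F y)"
      by (simp add: inner_diff_left inner_diff_right inner_commute)
  qed
  have fitzpatrick: "inner x u \<le> r" if "((x, u), r) \<in> E" for x u r
  proof (rule ccontr)
    assume "\<not> ?thesis"
    with that have pos: "inner (F y - u) (y - x) > 0" for y
      unfolding E_iff
      by (auto simp: inner_diff_left inner_diff_right inner_commute dest!: spec[of _ y])
    then have "F x = u" by (intro eq_if_monotonically_related F less_imp_le)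
    then show False using pos[of x] by simp
  qed
  have lower: "0 \<le> r + (norm z)\<^sup>2 / 2" if "(z, r) \<in> E" for z r
  proof -
    obtain x u where z: "z = (x, u)" by (cases z)
    have "0 \<le> inner (x + u) (x + u)" by simp
    then show ?thesis
      using fitzpatrick[of x u r] that unfolding z power2_norm_eq_inner
      by (simp add: inner_add_left inner_add_right inner_commute field_simps)
  qed
  obtain z r where zr: "(z, r) \<in> E"
      and opt: "\<And>q s. (q, s) \<in> E \<Longrightarrow> r + inner z z \<le> s + inner z q"
    using quadratic_epigraph_minimiser[OF cc _ lower] graph by blast
  obtain x u where z: "z = (x, u)" by (cases z)
  have key: "inner (x + u) (x + u) \<le> inner (F y + x) (y + u)" for y
    using opt[OF graph[of y]] fitzpatrick[of x u r] zr unfolding z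
    by (simp add: inner_add_left inner_add_right inner_commute)
  have "F (- u) = - x"
  proof (rule eq_if_monotonically_related[OF F(1)])
    fix y
    show "inner (F y - - x) (y - - u) \<ge> 0"
      using order_trans[OF inner_ge_zero key[of y]] by simp
  qed
  moreover from this have "inner (x + u) (x + u) \<le> 0" using key[of "- u"] by simp
  then have "x + u = 0" by (metis inner_gt_zero_iff not_le)
  ultimately have "F x + x = 0" by (metis add.commute add.right_inverse minus_unique)
  then show ?thesis by (rule that)
qed

text \<open>Scaling turns the regularized equation into \<open>H x + x = 0\<close> with \<open>H\<close> monotone and
  hemicontinuous; uniqueness is strong monotonicity.\<close>

lemma lavrentiev_unique_solution:
  fixes F :: "'a::{real_inner,complete_space} \<Rightarrow> 'a"
  assumes F: "hemicontinuous F" "monotone_operator F" and \<alpha>: "\<alpha> > 0"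
  shows "\<exists>!x. F x + \<alpha> *\<^sub>R (x - xbar) = yd"
proof (rule ex_ex1I)
  define H where "H x = inverse \<alpha> *\<^sub>R (F x - yd) - xbar" for x
  have "hemicontinuous H"
    using F(1) unfolding hemicontinuous_def H_def inner_diff_left inner_scaleR_left
    by (intro allI continuous_on_diff continuous_on_mult continuous_on_const) blast+
  moreover have "monotone_operator H"
  proof -
    have "H x - H x' = inverse \<alpha> *\<^sub>R (F x - F x')" for x x'
      by (simp add: H_def scaleR_diff_right)
    then show ?thesis using F(2) \<alpha> by (simp add: monotone_operator_def)
  qed
  ultimately obtain x where "H x + x = 0" by (rule monotone_hemicontinuous_plus_id_zero)
  then have "\<alpha> *\<^sub>R (H x + x) = 0" by simp
  then have "F x + \<alpha> *\<^sub>R (x - xbar) = yd"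
    using \<alpha> by (simp add: H_def scaleR_add_right scaleR_diff_right) (simp add: algebra_simps)
  then show "\<exists>x. F x + \<alpha> *\<^sub>R (x - xbar) = yd" ..
next
  fix x x' assume "F x + \<alpha> *\<^sub>R (x - xbar) = yd" "F x' + \<alpha> *\<^sub>R (x' - xbar) = yd"
  then have "F x - F x' = - (\<alpha> *\<^sub>R (x - x'))" by (simp add: algebra_simps)
  moreover have "inner (F x - F x') (x - x') \<ge> 0" using F(2) by (simp add: monotone_operator_def)
  ultimately have "\<alpha> * inner (x - x') (x - x') \<le> 0" by simp
  then have "inner (x - x') (x - x') = 0"
    using \<alpha> inner_ge_zero[of "x - x'"] by (simp add: mult_le_0_iff)
  then show "x = x'" by simp
qed

lemma lavrentiev_equation:
  fixes F :: "'a::{real_inner,complete_space} \<Rightarrow> 'a"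
  assumes "hemicontinuous F" "monotone_operator F" "\<alpha> > 0"
  shows "F (lavrentiev F xbar \<alpha> yd) + \<alpha> *\<^sub>R (lavrentiev F xbar \<alpha> yd - xbar) = yd"
  unfolding lavrentiev_def by (rule theI') (rule lavrentiev_unique_solution[OF assms])

section \<open>Index functions and their inverses\<close>

lemma index_function_strict_mono:
  assumes "index_function \<theta>"
  shows "strict_mono_on {0..} \<theta>"
proof (rule strict_mono_onI)
  fix s t :: real assume st: "s \<in> {0..}" "t \<in> {0..}" "s < t"
  then show "\<theta> s < \<theta> t"
    using assms by (cases "s = 0") (auto simp: index_function_def strict_mono_on_def)
qed

lemma index_function_less_iff:
  assumes "index_function \<theta>" "0 \<le> s" "0 \<le> t"
  shows "\<theta> s < \<theta> t \<longleftrightarrow> s < t"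
  using strict_mono_on_less[OF index_function_strict_mono[OF assms(1)]] assms by simp

lemma index_function_le_iff:
  assumes "index_function \<theta>" "0 \<le> s" "0 \<le> t"
  shows "\<theta> s \<le> \<theta> t \<longleftrightarrow> s \<le> t"
  using index_function_less_iff[OF assms(1,3,2)] by linarith

lemma index_function_nonneg:
  assumes "index_function \<theta>" "0 \<le> t"
  shows "0 \<le> \<theta> t"
  using assms by (cases "t = 0") (auto simp: index_function_def less_imp_le)

lemma index_function_continuous:
  assumes "index_function \<theta>"
  shows "continuous_on {0..} \<theta>"
  unfolding continuous_on_eq_continuous_within
proof
  fix t :: real assume t: "t \<in> {0..}"
  show "continuous (at t within {0..}) \<theta>"
  proof (cases "t = 0")
    case True
    then show ?thesis
      using assms by (simp add: continuous_within index_function_def at_within_Ici_at_right)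
  next
    case False
    then have "continuous (at t) \<theta>"
      using assms t continuous_on_eq_continuous_at[of "{0<..}" \<theta>]
      by (auto simp: index_function_def)
    then show ?thesis by (rule continuous_at_imp_continuous_within)
  qed
qed

lemma index_function_attains:
  assumes "index_function \<theta>" "0 \<le> b" "0 \<le> \<tau>" "\<tau> \<le> \<theta> b"
  obtains a where "0 \<le> a" "a \<le> b" "\<theta> a = \<tau>"
proof -
  have "\<theta> 0 = 0" using assms(1) by (simp add: index_function_def)
  moreover have "continuous_on {0..b} \<theta>"
    by (rule continuous_on_subset[OF index_function_continuous[OF assms(1)]]) auto
  ultimately show ?thesis using IVT'[of \<theta> 0 \<tau> b] assms that by auto
qed

lemma index_inv_apply:
  assumes "index_function \<theta>" "0 \<le> a"
  shows "index_inv \<theta> (\<theta> a) = a"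
  unfolding index_inv_def
  using assms strict_mono_on_imp_inj_on[OF index_function_strict_mono[OF assms(1)]]
  by (simp add: inv_into_f_f)

lemma index_inv_mono_on:
  assumes "index_function \<theta>" "0 \<le> b"
  shows "mono_on {0..\<theta> b} (index_inv \<theta>)"
proof (rule mono_onI)
  fix s t assume st: "s \<in> {0..\<theta> b}" "t \<in> {0..\<theta> b}" "s \<le> t"
  obtain u v where "0 \<le> u" "\<theta> u = s" "0 \<le> v" "\<theta> v = t"
    using st index_function_attains[OF assms] by (metis atLeastAtMost_iff)
  then show "index_inv \<theta> s \<le> index_inv \<theta> t"
    using st index_inv_apply[OF assms(1)] index_function_le_iff[OF assms(1)] by auto
qed

section \<open>Young's inequality\<close>

lemma integral_mono_on_bounds:
  fixes h :: "real \<Rightarrow> real"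
  assumes "mono_on {c..d} h" "c \<le> d"
  shows "(d - c) * h c \<le> integral {c..d} h" "integral {c..d} h \<le> (d - c) * h d"
proof -
  have h: "h integrable_on {c..d}" by (rule integrable_on_mono_on[OF assms(1)])
  have "integral {c..d} (\<lambda>_. h c) \<le> integral {c..d} h"
    using assms by (intro integral_le h) (auto simp: mono_on_def)
  then show "(d - c) * h c \<le> integral {c..d} h" using assms by simp
  have "integral {c..d} h \<le> integral {c..d} (\<lambda>_. h d)"
    using assms by (intro integral_le h) (auto simp: mono_on_def)
  then show "integral {c..d} h \<le> (d - c) * h d" using assms by simp
qed

lemma index_function_integral_split:
  assumes f: "index_function f" and ab: "0 \<le> a" "a \<le> b"
  shows "(b - a) * f a \<le> integral {0..b} f - integral {0..a} f"
    and "integral {0..b} f - integral {0..a} f \<le> (b - a) * f b"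
proof -
  have m: "mono_on {c..b} f" if "0 \<le> c" for c
    using that
    by (intro mono_on_subset[OF strict_mono_on_imp_mono_on[OF index_function_strict_mono[OF f]]])
      auto
  have "integral {0..a} f + integral {a..b} f = integral {0..b} f"
    using ab by (intro Henstock_Kurzweil_Integration.integral_combine integrable_on_mono_on m) auto
  then show "(b - a) * f a \<le> integral {0..b} f - integral {0..a} f"
      "integral {0..b} f - integral {0..a} f \<le> (b - a) * f b"
    using integral_mono_on_bounds[OF m[OF ab(1)] ab(2)] by auto
qed

text \<open>The equality case of Young's inequality: the areas below the graph of \<open>f\<close> and to its left fill
  the rectangle with sides \<open>a\<close> and \<open>f a\<close>. The defect \<open>T\<close> of this identity changes between \<open>c\<close> and \<open>b\<close> by at
  most \<open>(b - c) * (f b - f c)\<close>, the area of the small rectangle left uncertain by monotonicity.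
  As \<open>f\<close> is continuous, this makes the derivative of \<open>T\<close> vanish.\<close>

lemma integral_index_inv:
  assumes f: "index_function f" and a: "0 \<le> a"
  shows "integral {0..f a} (index_inv f) = a * f a - integral {0..a} f"
proof -
  define T where "T s = integral {0..s} f + integral {0..f s} (index_inv f) - s * f s" for s
  have increment: "\<bar>T b - T c\<bar> \<le> (b - c) * (f b - f c)" if cb: "0 \<le> c" "c \<le> b" for b c
  proof -
    have fcb: "0 \<le> f c" "f c \<le> f b"
      using index_function_nonneg[OF f] index_function_le_iff[OF f] cb by auto
    have m: "mono_on {d..f b} (index_inv f)" if "0 \<le> d" for d
      using cb that by (intro mono_on_subset[OF index_inv_mono_on[OF f, of b]]) auto
    have "integral {0..f c} (index_inv f) + integral {f c..f b} (index_inv f)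
        = integral {0..f b} (index_inv f)"
      using fcb by (intro Henstock_Kurzweil_Integration.integral_combine integrable_on_mono_on m) auto
    then have "T b - T c = (integral {0..b} f - integral {0..c} f)
        + integral {f c..f b} (index_inv f) - (b * f b - c * f c)"
      by (simp add: T_def)
    moreover have "(f b - f c) * c \<le> integral {f c..f b} (index_inv f)"
        "integral {f c..f b} (index_inv f) \<le> (f b - f c) * b"
      using integral_mono_on_bounds[OF m[OF fcb(1)] fcb(2)] index_inv_apply[OF f] cb by auto
    ultimately show ?thesis
      using index_function_integral_split[OF f cb] by (simp add: abs_le_iff algebra_simps)
  qed
  have "\<exists>c. \<forall>x\<in>{0..}. T x = c"
  proof (rule has_field_derivative_zero_constant)
    fix x :: real assume x: "x \<in> {0..}"
    have "(f \<longlongrightarrow> f x) (at x within {0..})"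
      using index_function_continuous[OF f] x by (simp add: continuous_on_def)
    then have lim: "((\<lambda>y. \<bar>f y - f x\<bar>) \<longlongrightarrow> 0) (at x within {0..})"
      by (intro tendsto_rabs_zero LIM_zero)
    have "\<forall>\<^sub>F y in at x within {0..}. norm ((T y - T x) / (y - x)) \<le> \<bar>f y - f x\<bar>"
      unfolding eventually_at_filter
    proof (intro always_eventually allI impI)
      fix y assume y: "y \<noteq> x" "y \<in> {0..}"
      have "\<bar>T y - T x\<bar> \<le> \<bar>y - x\<bar> * \<bar>f y - f x\<bar>"
      proof (cases "y \<le> x")
        case True
        then have "f y \<le> f x" using index_function_le_iff[OF f] x y by simp
        moreover have "\<bar>y - x\<bar> = x - y" "\<bar>T y - T x\<bar> = \<bar>T x - T y\<bar>" using True by auto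
        moreover have "\<bar>f y - f x\<bar> = f x - f y" using \<open>f y \<le> f x\<close> by simp
        ultimately show ?thesis using increment[of y x] True y by simp
      next
        case False
        then have "f x \<le> f y" using index_function_le_iff[OF f] x y by simp
        then show ?thesis using increment[of x y] False x by simp
      qed
      then show "norm ((T y - T x) / (y - x)) \<le> \<bar>f y - f x\<bar>"
        using y by (simp add: abs_divide divide_le_eq mult.commute)
    qed
    then have "((\<lambda>y. (T y - T x) / (y - x)) \<longlongrightarrow> 0) (at x within {0..})"
      using lim by (rule Lim_null_comparison)
    then show "(T has_field_derivative 0) (at x within {0..})"
      by (simp add: has_field_derivative_iff)
  qed simp
  then have "T a = T 0" using a by auto
  moreover have "f 0 = 0" using f by (simp add: index_function_def)
  ultimately show ?thesis by (simp add: T_def)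
qed

text \<open>The number \<open>\<alpha>\<close> may be the supremum of \<open>f\<close> and not a value of \<open>f\<close>. The proof therefore
  treats each \<open>\<tau> < \<alpha>\<close>, where \<open>\<tau> = f a\<close> and the equality case applies, and lets \<open>\<tau>\<close> tend to \<open>\<alpha>\<close>.\<close>

lemma young_inequality_index:
  assumes f: "index_function f" and \<alpha>: "inverse_integral_defined f \<alpha>" "0 < \<alpha>" and s: "0 \<le> s"
  shows "\<alpha> * s \<le> integral {0..s} f + integral {0..\<alpha>} (index_inv f)"
proof (rule field_le_mult_one_interval)
  fix z :: real assume z: "0 < z" "z < 1"
  define \<tau> where "\<tau> = z * \<alpha>"
  have \<tau>: "0 < \<tau>" "\<tau> < \<alpha>" using z \<alpha> by (auto simp: \<tau>_def)
  have int: "index_inv f integrable_on {0..\<alpha>}"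
    and range: "\<And>t. 0 < t \<Longrightarrow> t < \<alpha> \<Longrightarrow> \<exists>a>0. f a = t"
    using \<alpha>(1) by (auto simp: inverse_integral_defined_def)
  obtain a where a: "0 < a" "f a = \<tau>" using range \<tau> by blast
  have "(s - a) * \<tau> \<le> integral {0..s} f - integral {0..a} f"
  proof (cases "a \<le> s")
    case True
    then show ?thesis using index_function_integral_split(1)[OF f, of a s] a by simp
  next
    case False
    then have "integral {0..a} f - integral {0..s} f \<le> (a - s) * \<tau>"
      using index_function_integral_split(2)[OF f, of s a] a s by simp
    then show ?thesis by (simp add: left_diff_distrib)
  qed
  then have below: "\<tau> * s \<le> integral {0..s} f + integral {0..\<tau>} (index_inv f)"
    using integral_index_inv[OF f, of a] a by (simp add: algebra_simps)
  have "index_inv f integrable_on {\<tau>..\<alpha>}"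
    by (rule integrable_on_subinterval[OF int]) (use \<tau> in auto)
  \<comment> \<open>The open interval matters: at \<open>\<alpha>\<close> itself \<open>index_inv f\<close> may be an arbitrary value.\<close>
  then have "0 \<le> integral {\<tau><..<\<alpha>} (index_inv f)"
  proof (intro integral_nonneg)
    fix t assume "t \<in> {\<tau><..<\<alpha>}"
    then obtain b where "0 < b" "f b = t" using range[of t] \<tau> by auto
    then show "0 \<le> index_inv f t" using index_inv_apply[OF f, of b] by simp
  qed (simp add: integrable_on_open_interval_real)
  then have "0 \<le> integral {\<tau>..\<alpha>} (index_inv f)" by (simp add: integral_open_interval_real)
  moreover have "integral {0..\<tau>} (index_inv f) + integral {\<tau>..\<alpha>} (index_inv f)
      = integral {0..\<alpha>} (index_inv f)"
    using \<tau> by (intro Henstock_Kurzweil_Integration.integral_combine int) auto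
  ultimately show "z * (\<alpha> * s) \<le> integral {0..s} f + integral {0..\<alpha>} (index_inv f)"
    using below by (simp add: \<tau>_def algebra_simps)
qed

lemma inverse_integral_defined_small:
  assumes f: "index_function f" and \<alpha>: "0 \<le> \<alpha>" "\<alpha> \<le> f 1"
  shows "inverse_integral_defined f \<alpha>"
  unfolding inverse_integral_defined_def
proof
  show "{0<..<\<alpha>} \<subseteq> f ` {0<..}"
  proof
    fix t assume t: "t \<in> {0<..<\<alpha>}"
    then have "0 \<le> t" "t \<le> f 1" using \<alpha> by auto
    then obtain a where "0 \<le> a" "f a = t"
      using index_function_attains[OF f zero_le_one] by blast
    moreover have "f 0 = 0" using f by (simp add: index_function_def)
    ultimately have "0 < a" using t by (cases "a = 0") auto
    then show "t \<in> f ` {0<..}" using \<open>f a = t\<close> by (intro image_eqI[of _ f a]) auto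
  qed
  show "index_inv f integrable_on {0..\<alpha>}"
    using mono_on_subset[OF index_inv_mono_on[OF f, of 1], of "{0..\<alpha>}"] \<alpha>
    by (intro integrable_on_mono_on) auto
qed

lemma eventually_inverse_integral_defined:
  assumes f: "index_function f"
  shows "\<forall>\<^sub>F a in at_right 0. inverse_integral_defined f a"
proof -
  have "0 < f 1" using f by (simp add: index_function_def)
  then show ?thesis
    using inverse_integral_defined_small[OF f]
    by (intro eventually_at_rightI[of 0 "f 1"]) auto
qed

section \<open>The a priori parameter\<close>

lemma index_function_Theta:
  assumes "index_function (Psi G)"
  shows "index_function (Theta G)"
proof -
  have P: "continuous_on {0<..} (Psi G)" "\<And>s t. 0 < s \<Longrightarrow> s < t \<Longrightarrow> Psi G s < Psi G t"
      "\<And>t. 0 < t \<Longrightarrow> 0 < Psi G t" "(Psi G \<longlongrightarrow> 0) (at_right 0)"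
    using assms by (auto simp: index_function_def strict_mono_on_def)
  have "continuous_on {0<..} (Theta G)"
    unfolding Theta_def by (intro continuous_intros P)
  moreover have "strict_mono_on {0<..} (Theta G)"
    by (rule strict_mono_onI) (auto simp: Theta_def intro!: mult_strict_mono power_strict_mono P less_imp_le)
  moreover have "((\<lambda>t. t\<^sup>2 * Psi G t) \<longlongrightarrow> 0\<^sup>2 * 0) (at_right 0)"
    by (intro tendsto_intros P(4))
  ultimately show ?thesis
    using P(3) by (auto simp: index_function_def Theta_def[abs_def])
qed

lemma Theta_unbounded:
  assumes "index_function (Psi G)" "0 \<le> t"
  obtains b where "0 \<le> b" "t \<le> Theta G b"
proof -
  define b where "b = max 1 (t / Psi G 1)"
  have P1: "0 < Psi G 1" using assms(1) by (simp add: index_function_def)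
  have b: "1 \<le> b" "t / Psi G 1 \<le> b" by (auto simp: b_def)
  have "t \<le> b * Psi G 1" using b(2) P1 by (simp add: divide_le_eq)
  also have "\<dots> \<le> b\<^sup>2 * Psi G b"
    using b P1 index_function_le_iff[OF assms(1), of 1 b]
    by (intro mult_mono) (auto simp: power2_eq_square)
  finally show ?thesis using b by (intro that[of b]) (auto simp: Theta_def)
qed

text \<open>The defining equation \<open>\<alpha>\<^sup>2 \<Psi>(\<alpha>) = \<delta>\<^sup>2\<close> balances the two terms of the error estimate up to
  constants: \<open>\<delta>/\<alpha>\<close> is the square root of \<open>\<Psi>(\<alpha>)\<close>, not only of the same order.\<close>

lemma alpha_apri:
  assumes P: "index_function (Psi G)" and \<delta>: "0 < \<delta>"
  shows alpha_apri_pos: "0 < alpha_apri G \<delta>"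
    and Theta_alpha_apri: "Theta G (alpha_apri G \<delta>) = \<delta>\<^sup>2"
    and Psi_alpha_apri: "Psi G (alpha_apri G \<delta>) = (\<delta> / alpha_apri G \<delta>)\<^sup>2"
proof -
  note T = index_function_Theta[OF P]
  obtain b where "0 \<le> b" "\<delta>\<^sup>2 \<le> Theta G b"
    using Theta_unbounded[OF P zero_le_power2] by blast
  then obtain a where a: "0 \<le> a" "Theta G a = \<delta>\<^sup>2"
    using index_function_attains[OF T _ zero_le_power2] by blast
  then have eq: "alpha_apri G \<delta> = a"
    using index_inv_apply[OF T, of a] by (simp add: alpha_apri_def)
  have "a \<noteq> 0" using a \<delta> by (auto simp: Theta_def)
  then show "0 < alpha_apri G \<delta>" "Theta G (alpha_apri G \<delta>) = \<delta>\<^sup>2"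
      "Psi G (alpha_apri G \<delta>) = (\<delta> / alpha_apri G \<delta>)\<^sup>2"
    using a eq by (auto simp: Theta_def power_divide field_simps)
qed

lemma filterlim_alpha_apri:
  assumes P: "index_function (Psi G)"
  shows "filterlim (alpha_apri G) (at_right 0) (at_right 0)"
proof -
  note T = index_function_Theta[OF P]
  have pos: "\<forall>\<^sub>F \<delta> in at_right 0. 0 < alpha_apri G \<delta>"
    using alpha_apri_pos[OF P] by (intro eventually_at_rightI[of 0 1]) auto
  have "(alpha_apri G \<longlongrightarrow> 0) (at_right 0)"
  proof (rule order_tendstoI)
    fix \<epsilon> :: real assume \<epsilon>: "0 < \<epsilon>"
    then have "0 < Theta G \<epsilon>" using T by (simp add: index_function_def)
    then have "\<forall>\<^sub>F \<delta> in at_right 0. \<delta> \<in> {0<..<sqrt (Theta G \<epsilon>)}"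
      by (intro eventually_at_right_real) simp
    then show "\<forall>\<^sub>F \<delta> in at_right 0. alpha_apri G \<delta> < \<epsilon>"
    proof eventually_elim
      case (elim \<delta>)
      then have "\<delta>\<^sup>2 < (sqrt (Theta G \<epsilon>))\<^sup>2" by (intro power_strict_mono) auto
      then have "Theta G (alpha_apri G \<delta>) < Theta G \<epsilon>"
        using elim \<open>0 < Theta G \<epsilon>\<close> Theta_alpha_apri[OF P, of \<delta>] by simp
      then show ?case
        using elim \<epsilon> alpha_apri_pos[OF P, of \<delta>] index_function_less_iff[OF T] by simp
    qed
  qed (use pos in \<open>auto elim: eventually_mono\<close>)
  then show ?thesis using pos by (simp add: filterlim_at eventually_mono)
qed

lemma rate_tendsto_0:
  assumes P: "index_function (Psi G)"
  shows "((\<lambda>\<delta>. \<delta> / alpha_apri G \<delta>) \<longlongrightarrow> 0) (at_right 0)"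
proof -
  have "(Psi G \<longlongrightarrow> 0) (at_right 0)" using P by (simp add: index_function_def)
  from filterlim_compose[OF this filterlim_alpha_apri[OF P]]
  have "((\<lambda>\<delta>. sqrt (Psi G (alpha_apri G \<delta>))) \<longlongrightarrow> sqrt 0) (at_right 0)"
    by (rule tendsto_real_sqrt)
  moreover have "\<forall>\<^sub>F \<delta> in at_right 0. sqrt (Psi G (alpha_apri G \<delta>)) = \<delta> / alpha_apri G \<delta>"
    using Psi_alpha_apri[OF P] alpha_apri_pos[OF P]
    by (intro eventually_at_rightI[of 0 1]) (auto simp: less_imp_le)
  ultimately show ?thesis by (simp add: tendsto_cong)
qed

section \<open>Vanishing noise\<close>

lemma eventually_noise_level:
  assumes "eventually P (at_right 0)"
  shows "\<forall>\<^sub>F (\<delta>, yd) in noise_to_0 y. P \<delta>"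
  unfolding noise_to_0_def eventually_inf_principal eventually_filtercomap
  using assms by (intro exI[of _ P]) auto

lemma eventually_noise_data:
  "\<forall>\<^sub>F (\<delta>, yd) in noise_to_0 y. 0 < \<delta> \<and> norm (y - yd) \<le> \<delta>"
  unfolding noise_to_0_def eventually_inf_principal eventually_filtercomap
  by (intro exI[of _ "\<lambda>\<delta>. 0 < \<delta>"]) (auto simp: eventually_at_right_less)

section \<open>The error estimate\<close>

text \<open>The conditions on \<open>f\<close> and \<open>G\<close> are made for this inequality. Young's inequality separates
  \<open>\<alpha>\<close> and \<open>\<phi> t\<close>; the antiderivative of \<open>f\<close> undoes \<open>\<phi>\<close> and leaves \<open>t\<close>, while the integral of the inverse
  is below \<open>G\<close>. It serves both the error estimate, as an upper bound for \<open>\<phi>\<close>, and the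
  optimality of the rate, as a lower bound for \<open>G\<close>.\<close>

lemma scaled_phi_le:
  assumes \<phi>: "index_function \<phi>" and con: "Psi_construction \<phi> f G"
    and \<alpha>: "0 < \<alpha>" "inverse_integral_defined f \<alpha>" and t: "0 \<le> t"
  shows "\<alpha> * \<phi> t \<le> t + G \<alpha>"
proof -
  have f: "index_function f" and G: "integral {0..\<alpha>} (index_inv f) \<le> G \<alpha>"
      and A: "\<And>s. 0 < s \<Longrightarrow> integral {0..\<phi> s} f \<le> s"
    using con \<alpha> by (auto simp: Psi_construction_def)
  have \<phi>0: "\<phi> 0 = 0" using \<phi> by (simp add: index_function_def)
  have "\<alpha> * \<phi> t \<le> integral {0..\<phi> t} f + integral {0..\<alpha>} (index_inv f)"
    by (rule young_inequality_index[OF f \<alpha>(2,1) index_function_nonneg[OF \<phi> t]])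
  moreover have "integral {0..\<phi> t} f \<le> t"
    using A[of t] t \<phi>0 by (cases "t = 0") auto
  ultimately show ?thesis using G by linarith
qed

lemma quadratic_absorption:
  fixes k e u P :: real
  assumes k: "0 < k" and le: "k * e\<^sup>2 \<le> u * e + P"
  shows "e\<^sup>2 \<le> 1 / k\<^sup>2 * u\<^sup>2 + 2 / k * P"
proof -
  have "k * (k * e\<^sup>2) \<le> k * (u * e + P)" using k le by simp
  moreover have "0 \<le> (k * e - u)\<^sup>2" by simp
  ultimately have "k\<^sup>2 * e\<^sup>2 \<le> u\<^sup>2 + 2 * k * P"
    by (simp add: power2_eq_square algebra_simps)
  then have "e\<^sup>2 \<le> (u\<^sup>2 + 2 * k * P) / k\<^sup>2" using k by (simp add: le_divide_eq mult.commute)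
  also have "\<dots> = 1 / k\<^sup>2 * u\<^sup>2 + 2 / k * P"
    using k by (simp add: add_divide_distrib power2_eq_square)
  finally show ?thesis .
qed

text \<open>The equation is tested with \<open>x - xdag\<close>. Monotonicity produces the term \<open>D\<close>, and the
  variational inequality bounds the remaining inner product by \<open>\<beta> e\<^sup>2 + \<phi> D\<close>. Since
  \<open>\<alpha> \<phi> D\<close> is at most \<open>D + G \<alpha>\<close>, the term \<open>D\<close> cancels and a quadratic inequality for the error
  \<open>e\<close> is left.\<close>

lemma lavrentiev_error_estimate:
  fixes F :: "'a::{real_inner,complete_space} \<Rightarrow> 'a" and xdag xbar yd :: 'a and \<alpha> :: real
  defines "x \<equiv> lavrentiev F xbar \<alpha> yd"
  assumes F: "hemicontinuous F" "monotone_operator F"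
    and \<beta>: "\<beta> < 1" and \<phi>: "index_function \<phi>" and con: "Psi_construction \<phi> f G"
    and \<alpha>: "0 < \<alpha>" "inverse_integral_defined f \<alpha>" and yd: "norm (F xdag - yd) \<le> \<delta>"
    and vi: "inner (xdag - xbar) (xdag - x)
       \<le> \<beta> * (norm (x - xdag))\<^sup>2 + \<phi> (inner (F x - F xdag) (x - xdag))"
  shows "(norm (x - xdag))\<^sup>2 \<le> 1 / (1 - \<beta>)\<^sup>2 * (\<delta>\<^sup>2 / \<alpha>\<^sup>2) + 2 / (1 - \<beta>) * Psi G \<alpha>"
proof -
  define e where "e = norm (x - xdag)"
  define D where "D = inner (F x - F xdag) (x - xdag)"
  have D: "0 \<le> D" using F(2) by (simp add: D_def monotone_operator_def)
  have Fx: "F x = yd - \<alpha> *\<^sub>R (x - xbar)"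
    using lavrentiev_equation[OF F \<alpha>(1), of xbar yd] by (simp add: x_def algebra_simps)
  have "D + \<alpha> * e\<^sup>2 = inner (yd - F xdag) (x - xdag) + \<alpha> * inner (xdag - xbar) (xdag - x)"
    unfolding D_def e_def power2_norm_eq_inner Fx
    by (simp add: inner_diff_left inner_diff_right inner_commute algebra_simps)
  also have "inner (yd - F xdag) (x - xdag) \<le> norm (yd - F xdag) * e"
    unfolding e_def by (rule norm_cauchy_schwarz)
  also have "\<dots> \<le> \<delta> * e"
    using yd by (intro mult_right_mono) (auto simp: e_def norm_minus_commute)
  also have "\<alpha> * inner (xdag - xbar) (xdag - x) \<le> \<alpha> * (\<beta> * e\<^sup>2 + \<phi> D)"
    using vi \<alpha> by (intro mult_left_mono) (auto simp: e_def D_def)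
  finally have "D + \<alpha> * e\<^sup>2 \<le> \<delta> * e + \<alpha> * (\<beta> * e\<^sup>2 + \<phi> D)" by simp
  then have "\<alpha> * ((1 - \<beta>) * e\<^sup>2) \<le> \<delta> * e + G \<alpha>"
    using scaled_phi_le[OF \<phi> con \<alpha> D] by (simp add: algebra_simps)
  then have "(1 - \<beta>) * e\<^sup>2 \<le> \<delta> / \<alpha> * e + Psi G \<alpha>"
    using \<alpha> by (simp add: Psi_def field_simps)
  then have "e\<^sup>2 \<le> 1 / (1 - \<beta>)\<^sup>2 * (\<delta> / \<alpha>)\<^sup>2 + 2 / (1 - \<beta>) * Psi G \<alpha>"
    using \<beta> by (intro quadratic_absorption) auto
  then show ?thesis by (simp add: e_def power_divide)
qed

lemma Sigma_bound_nonneg: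
  assumes "\<beta> < 1" "0 \<le> \<delta>" "0 < \<alpha>"
  shows "0 \<le> Sigma_bound \<beta> \<alpha> \<delta>"
  using assms by (simp add: Sigma_bound_def)

lemma Sigma_bound_power2:
  assumes "\<beta> < 1"
  shows "(Sigma_bound \<beta> \<alpha> \<delta>)\<^sup>2 = (1 / (1 - \<beta>)\<^sup>2 + 2 / (1 - \<beta>)) * (\<delta> / \<alpha>)\<^sup>2"
proof -
  have "(sqrt (3 - 2 * \<beta>) / (1 - \<beta>))\<^sup>2 = (3 - 2 * \<beta>) / (1 - \<beta>)\<^sup>2"
    using assms by (simp add: power_divide)
  also have "\<dots> = 1 / (1 - \<beta>)\<^sup>2 + 2 / (1 - \<beta>)"
    using assms by (simp add: power2_eq_square divide_simps)
  finally show ?thesis by (simp only: Sigma_bound_def power_mult_distrib)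
qed

lemma Sigma_bound_le:
  assumes "\<beta> < 1" "0 \<le> \<delta>" "0 < c" "0 < A" "c * A \<le> p"
  shows "Sigma_bound \<beta> p \<delta> \<le> Sigma_bound \<beta> A \<delta> / c"
proof -
  have "0 < c * A" using assms by simp
  moreover from this have "0 < p" using assms by linarith
  ultimately have "\<delta> / p \<le> \<delta> / (c * A)"
    using assms by (intro divide_left_mono mult_pos_pos) auto
  then have "Sigma_bound \<beta> p \<delta> \<le> sqrt (3 - 2 * \<beta>) / (1 - \<beta>) * (\<delta> / (c * A))"
    unfolding Sigma_bound_def using assms by (intro mult_left_mono) auto
  then show ?thesis by (simp add: Sigma_bound_def mult_ac)
qed

text \<open>To the left of the a priori parameter the noise term dominates, because \<open>\<Psi>\<close> increases and
  \<open>\<delta>/\<alpha>\<close> decreases and they balance there. The square of the constant in \<open>Sigma_bound\<close> is the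
  sum of the two constants in the error estimate.\<close>

lemma error_le_Sigma_bound:
  assumes P: "index_function (Psi G)" and \<beta>: "\<beta> < 1" and \<delta>: "0 < \<delta>"
    and \<alpha>: "0 < \<alpha>" "\<alpha> \<le> alpha_apri G \<delta>" and e: "0 \<le> e"
    and est: "e\<^sup>2 \<le> 1 / (1 - \<beta>)\<^sup>2 * (\<delta>\<^sup>2 / \<alpha>\<^sup>2) + 2 / (1 - \<beta>) * Psi G \<alpha>"
  shows "e \<le> Sigma_bound \<beta> \<alpha> \<delta>"
proof (rule power2_le_imp_le)
  have "Psi G \<alpha> \<le> Psi G (alpha_apri G \<delta>)"
    using index_function_le_iff[OF P] \<alpha> by simp
  also have "\<dots> = (\<delta> / alpha_apri G \<delta>)\<^sup>2" by (rule Psi_alpha_apri[OF P \<delta>])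
  also have "\<dots> \<le> (\<delta> / \<alpha>)\<^sup>2"
    using \<alpha> \<delta> by (intro power_mono divide_left_mono) auto
  finally have "2 / (1 - \<beta>) * Psi G \<alpha> \<le> 2 / (1 - \<beta>) * (\<delta> / \<alpha>)\<^sup>2"
    using \<beta> by (intro mult_left_mono) auto
  then show "e\<^sup>2 \<le> (Sigma_bound \<beta> \<alpha> \<delta>)\<^sup>2"
    using est unfolding Sigma_bound_power2[OF \<beta>] power_divide distrib_right by linarith
  show "0 \<le> Sigma_bound \<beta> \<alpha> \<delta>" using \<beta> \<delta> \<alpha> by (simp add: Sigma_bound_nonneg)
qed

section \<open>The exponent one third\<close>

lemma cube_compare:
  fixes a w c :: real
  assumes "0 < c" "0 \<le> a" "0 \<le> w"
  shows "c * a ^ 3 \<le> w ^ 3 \<longleftrightarrow> root 3 c * a \<le> w"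
    and "w ^ 3 \<le> c * a ^ 3 \<longleftrightarrow> w \<le> root 3 c * a"
proof -
  have "c * a ^ 3 = (root 3 c * a) ^ 3" using assms by (simp add: power_mult_distrib)
  then show "c * a ^ 3 \<le> w ^ 3 \<longleftrightarrow> root 3 c * a \<le> w" "w ^ 3 \<le> c * a ^ 3 \<longleftrightarrow> w \<le> root 3 c * a"
    using assms by auto
qed

lemma powr_thirds:
  fixes \<delta> :: real
  assumes "0 < \<delta>"
  shows "(\<delta> powr (2/3)) ^ 3 = \<delta>\<^sup>2" "\<delta> powr (2/3) = (\<delta> powr (1/3))\<^sup>2"
    "\<delta> / \<delta> powr (2/3) = \<delta> powr (1/3)"
proof -
  show "(\<delta> powr (2/3)) ^ 3 = \<delta>\<^sup>2" "\<delta> powr (2/3) = (\<delta> powr (1/3))\<^sup>2"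
    using assms by (simp_all add: powr_power)
  have "\<delta> / \<delta> powr (2/3) = \<delta> powr 1 / \<delta> powr (2/3)" using assms by simp
  also have "\<dots> = \<delta> powr (1 - 2/3)" by (rule powr_diff[symmetric])
  finally show "\<delta> / \<delta> powr (2/3) = \<delta> powr (1/3)" by simp
qed

lemma alpha_apri_bigtheta:
  assumes P: "index_function (Psi G)" and lin: "Psi G \<in> \<Theta>[at_right 0](\<lambda>t. t)"
  shows "alpha_apri G \<in> \<Theta>[at_right 0](\<lambda>\<delta>. \<delta> powr (2/3))"
proof -
  from lin obtain c d where c: "0 < c" "\<forall>\<^sub>F t in at_right 0. norm (Psi G t) \<ge> c * norm t"
      and d: "0 < d" "\<forall>\<^sub>F t in at_right 0. norm (Psi G t) \<le> d * norm t"
    by (auto simp: bigtheta_def elim!: landau_o.bigE landau_omega.bigE)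
  note ev = eventually_compose_filterlim[OF _ filterlim_alpha_apri[OF P]]
  have bounds: "\<forall>\<^sub>F \<delta> in at_right 0. root 3 c * alpha_apri G \<delta> \<le> \<delta> powr (2/3) \<and>
      \<delta> powr (2/3) \<le> root 3 d * alpha_apri G \<delta>"
    using ev[OF c(2)] ev[OF d(2)] eventually_at_right_less[of 0]
  proof eventually_elim
    case (elim \<delta>)
    define a where "a = alpha_apri G \<delta>"
    have a: "0 < a" "a\<^sup>2 * Psi G a = \<delta>\<^sup>2"
      using alpha_apri[OF P, of \<delta>] elim by (auto simp: a_def Theta_def)
    have "0 < Psi G a" using P a by (simp add: index_function_def)
    then have "c * a \<le> Psi G a" "Psi G a \<le> d * a" using elim a by (auto simp: a_def)
    then have "a\<^sup>2 * (c * a) \<le> \<delta>\<^sup>2" "\<delta>\<^sup>2 \<le> a\<^sup>2 * (d * a)"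
      unfolding a(2)[symmetric] by (auto intro: mult_left_mono)
    then have "c * a ^ 3 \<le> (\<delta> powr (2/3)) ^ 3" "(\<delta> powr (2/3)) ^ 3 \<le> d * a ^ 3"
      unfolding powr_thirds(1)[OF elim(3)]
      by (simp_all add: power2_eq_square power3_eq_cube mult_ac)
    then show ?case using cube_compare c(1) d(1) a(1) by (simp add: a_def)
  qed
  show ?thesis
  proof (rule bigthetaI)
    have "\<forall>\<^sub>F \<delta> in at_right 0. norm (alpha_apri G \<delta>) \<le> 1 / root 3 c * norm (\<delta> powr (2/3))"
      using bounds eventually_at_right_less[of 0]
      by eventually_elim (use c(1) in \<open>simp add: abs_of_pos alpha_apri_pos[OF P] field_simps\<close>)
    then show "alpha_apri G \<in> O[at_right 0](\<lambda>\<delta>. \<delta> powr (2/3))" by (rule bigoI)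
    have "\<forall>\<^sub>F \<delta> in at_right 0. norm (\<delta> powr (2/3)) \<le> root 3 d * norm (alpha_apri G \<delta>)"
      using bounds eventually_at_right_less[of 0]
      by eventually_elim (simp add: abs_of_pos alpha_apri_pos[OF P])
    then have "(\<lambda>\<delta>. \<delta> powr (2/3)) \<in> O[at_right 0](alpha_apri G)" by (rule bigoI)
    then show "alpha_apri G \<in> \<Omega>[at_right 0](\<lambda>\<delta>. \<delta> powr (2/3))"
      by (simp add: bigomega_iff_bigo)
  qed
qed

lemma rate_lower_bound:
  assumes P: "index_function (Psi G)" and k: "0 < k"
    and low: "\<forall>\<^sub>F a in at_right 0. k * a \<le> Psi G a"
  shows "\<forall>\<^sub>F \<delta> in at_right 0. root 3 k * \<delta> powr (1/3) \<le> \<delta> / alpha_apri G \<delta>"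
  using eventually_compose_filterlim[OF low filterlim_alpha_apri[OF P]]
    eventually_at_right_less[of 0]
proof eventually_elim
  case (elim \<delta>)
  define a where "a = alpha_apri G \<delta>"
  have a: "0 < a" "a\<^sup>2 * Psi G a = \<delta>\<^sup>2"
    using alpha_apri[OF P, of \<delta>] elim by (auto simp: a_def Theta_def)
  have "a\<^sup>2 * (k * a) \<le> \<delta>\<^sup>2"
    unfolding a(2)[symmetric] using elim by (intro mult_left_mono) (auto simp: a_def)
  then have "k * a ^ 3 \<le> (\<delta> powr (2/3)) ^ 3"
    unfolding powr_thirds(1)[OF elim(2)] by (simp add: power2_eq_square power3_eq_cube mult_ac)
  then have le: "root 3 k * a \<le> \<delta> powr (2/3)" using cube_compare(1)[of k a] k a by simp
  have "root 3 k * \<delta> powr (1/3) = root 3 k * (\<delta> / \<delta> powr (2/3))"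
    using elim by (simp add: powr_thirds(3))
  also have "\<dots> = root 3 k * \<delta> / \<delta> powr (2/3)" by simp
  also have "\<dots> \<le> root 3 k * \<delta> / (root 3 k * a)"
    using le k a elim by (intro divide_left_mono mult_pos_pos mult_nonneg_nonneg) auto
  also have "\<dots> = \<delta> / a" using k by simp
  finally show ?case by (simp add: a_def)
qed

text \<open>For \<open>a\<close> of the order \<open>\<delta> powr (2/3)\<close> both terms of the error estimate have that order, which is the
  square of the rate.\<close>

lemma one_third_rate:
  fixes e a :: real
  assumes \<delta>: "0 < \<delta>" and c: "0 < c" and a: "c * \<delta> powr (2/3) \<le> a" "a \<le> d * \<delta> powr (2/3)"
    and K: "0 \<le> K" "0 \<le> L"
    and est: "e\<^sup>2 \<le> K * (\<delta>\<^sup>2 / a\<^sup>2) + L * a"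
  shows "\<bar>e\<bar> \<le> sqrt (K / c\<^sup>2 + L * d) * \<delta> powr (1/3)"
proof -
  define v where "v = \<delta> powr (1/3)"
  have v: "0 < v" "\<delta> powr (2/3) = v\<^sup>2" "\<delta> / v\<^sup>2 = v"
    using \<delta> powr_thirds[OF \<delta>] by (auto simp: v_def)
  have cv: "0 < c * v\<^sup>2" "c * v\<^sup>2 \<le> a" using a(1) c v by auto
  then have "0 < a" by linarith
  have "\<delta> / a \<le> \<delta> / (c * v\<^sup>2)"
    using cv \<open>0 < a\<close> \<delta> by (intro divide_left_mono) auto
  also have "\<dots> = v / c" using v(3) by (metis divide_divide_eq_left mult.commute)
  finally have "(\<delta> / a)\<^sup>2 \<le> (v / c)\<^sup>2"
    using \<open>0 < a\<close> \<delta> by (intro power_mono) auto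
  then have "K * (\<delta>\<^sup>2 / a\<^sup>2) \<le> K * (v\<^sup>2 / c\<^sup>2)"
    using K by (intro mult_left_mono) (auto simp: power_divide)
  moreover have "L * a \<le> L * (d * v\<^sup>2)" using K a v by (intro mult_left_mono) auto
  ultimately have "e\<^sup>2 \<le> (K / c\<^sup>2 + L * d) * v\<^sup>2" using est by (simp add: distrib_right)
  then have "sqrt (e\<^sup>2) \<le> sqrt ((K / c\<^sup>2 + L * d) * v\<^sup>2)" by (rule real_sqrt_le_mono)
  then show ?thesis using v by (simp add: real_sqrt_mult v_def)
qed

text \<open>If \<open>\<phi>\<close> is at least \<open>c\<close> times the square root, then \<open>a c \<surd>t - t \<le> G a\<close> for all small
  \<open>t\<close>; the left side is largest at \<open>t = (a c / 2)\<^sup>2\<close>, where it equals \<open>c\<^sup>2 a\<^sup>2 / 4\<close>.\<close>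

lemma Psi_lower_bound:
  assumes \<phi>: "index_function \<phi>" and con: "Psi_construction \<phi> f G" and c: "0 < c"
    and low: "\<forall>\<^sub>F t in at_right 0. c * sqrt t \<le> \<phi> t"
  shows "\<forall>\<^sub>F a in at_right 0. c\<^sup>2 / 4 * a \<le> Psi G a"
proof -
  have f: "index_function f" using con by (simp add: Psi_construction_def)
  have "filterlim (\<lambda>a. (a * c / 2)\<^sup>2) (at_right 0) (at_right 0)"
    unfolding filterlim_at
  proof
    have "((\<lambda>a. (a * c / 2)\<^sup>2) \<longlongrightarrow> (0 * c / 2)\<^sup>2) (at_right 0)" by (intro tendsto_intros) auto
    then show "((\<lambda>a. (a * c / 2)\<^sup>2) \<longlongrightarrow> 0) (at_right 0)" by simp
    show "\<forall>\<^sub>F a in at_right 0. (a * c / 2)\<^sup>2 \<in> {0<..} \<and> (a * c / 2)\<^sup>2 \<noteq> 0"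
      using c by (intro eventually_at_rightI[of 0 1]) auto
  qed
  then have "\<forall>\<^sub>F a in at_right 0. c * sqrt ((a * c / 2)\<^sup>2) \<le> \<phi> ((a * c / 2)\<^sup>2)"
    by (rule eventually_compose_filterlim[OF low])
  moreover have "\<forall>\<^sub>F a in at_right (0::real). 0 < a" by (rule eventually_at_right_less)
  ultimately show ?thesis using eventually_inverse_integral_defined[OF f]
  proof eventually_elim
    case (elim a)
    have "c * (a * c / 2) \<le> \<phi> ((a * c / 2)\<^sup>2)" using elim c by simp
    then have "a * (c * (a * c / 2)) \<le> a * \<phi> ((a * c / 2)\<^sup>2)"
      using elim by (intro mult_left_mono) auto
    also have "\<dots> \<le> (a * c / 2)\<^sup>2 + G a"
      using elim by (intro scaled_phi_le[OF \<phi> con]) auto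
    finally have "a * (c\<^sup>2 / 4 * a) \<le> G a" by (simp add: power2_eq_square field_simps)
    then show ?case using elim by (simp add: Psi_def le_divide_eq mult.commute)
  qed
qed

section \<open>The balancing principle\<close>

lemma lepskii_grid_ge:
  assumes "0 < q" "q < 1" "0 < a0" "\<alpha> \<in> lepskii_grid q a0"
  shows "a0 \<le> \<alpha>"
  using assms by (auto simp: lepskii_grid_def le_divide_eq power_le_one)

lemma lepskii_grid_point_below:
  assumes q: "0 < q" "q < 1" and a0: "0 < a0" "a0 \<le> A"
  obtains p where "p \<in> lepskii_grid q a0" "p \<le> A" "q * A \<le> p"
proof -
  have "\<exists>j. A < a0 / q ^ j"
  proof -
    obtain n where "q ^ n < a0 / A" using real_arch_pow_inv[of "a0 / A" q] q a0 by auto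
    then show ?thesis using q a0 by (intro exI[of _ n]) (simp add: field_simps)
  qed
  then obtain j where j: "A < a0 / q ^ j" "\<And>i. i < j \<Longrightarrow> \<not> A < a0 / q ^ i"
    using exists_least_iff[of "\<lambda>j. A < a0 / q ^ j"] by auto
  then obtain i where i: "j = Suc i" using a0 by (cases j) auto
  show ?thesis
  proof (rule that)
    show "a0 / q ^ i \<in> lepskii_grid q a0" by (auto simp: lepskii_grid_def)
    show "a0 / q ^ i \<le> A" using j(2)[of i] i by simp
    show "q * A \<le> a0 / q ^ i" using j(1) q unfolding i by (simp add: field_simps)
  qed
qed

text \<open>The comparison point \<open>p\<close> is the last grid point up to \<open>A\<close>, or the starting point if the
  whole grid lies beyond \<open>A\<close>. Up to \<open>p\<close> all errors are below \<open>Sigma_bound\<close>, so differences of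
  approximations pass the test with the factor 2; and \<open>p\<close> is at least \<open>q * A\<close>.\<close>

lemma lepskii_set_contains_balanced_point:
  fixes F :: "'a::real_inner \<Rightarrow> 'a" and xdag xbar yd :: 'a
  defines "e \<equiv> \<lambda>\<alpha>. norm (lavrentiev F xbar \<alpha> yd - xdag)"
  assumes q: "0 < q" "q < 1" and a0: "0 < a0" and A: "0 < A" and \<beta>: "\<beta> < 1" and \<delta>: "0 < \<delta>"
    and e0: "e a0 \<le> Sigma_bound \<beta> a0 \<delta>"
    and eA: "\<And>\<alpha>. \<alpha> \<in> lepskii_grid q a0 \<Longrightarrow> \<alpha> \<le> A \<Longrightarrow> e \<alpha> \<le> Sigma_bound \<beta> \<alpha> \<delta>"
  obtains p where "p \<in> lepskii_set F xbar \<beta> q a0 \<delta> yd"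
    and "e p \<le> Sigma_bound \<beta> p \<delta>" and "Sigma_bound \<beta> p \<delta> \<le> Sigma_bound \<beta> A \<delta> / q"
proof -
  have start: "a0 \<in> lepskii_grid q a0" by (auto simp: lepskii_grid_def intro: exI[of _ 0])
  obtain p where p: "p \<in> lepskii_grid q a0" "q * A \<le> p"
    and near: "\<And>\<alpha>. \<alpha> \<in> lepskii_grid q a0 \<Longrightarrow> \<alpha> \<le> p \<Longrightarrow> e \<alpha> \<le> Sigma_bound \<beta> \<alpha> \<delta>"
  proof (cases "a0 \<le> A")
    case True
    then obtain p where "p \<in> lepskii_grid q a0" "p \<le> A" "q * A \<le> p"
      using lepskii_grid_point_below[OF q a0] by blast
    then show ?thesis using that[of p] eA by force
  next
    case False
    then have "q * A \<le> a0" using q A mult_mono[of q 1 A a0] a0 by simp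
    moreover have "e \<alpha> \<le> Sigma_bound \<beta> \<alpha> \<delta>" if "\<alpha> \<in> lepskii_grid q a0" "\<alpha> \<le> a0" for \<alpha>
      using lepskii_grid_ge[OF q a0 that(1)] that(2) e0 by simp
    ultimately show ?thesis using that[of a0] start by blast
  qed
  have "norm (lavrentiev F xbar \<alpha> yd - lavrentiev F xbar p yd) \<le> 2 * Sigma_bound \<beta> \<alpha> \<delta>"
    if \<alpha>: "\<alpha> \<in> lepskii_grid q a0" "\<alpha> \<le> p" for \<alpha>
  proof -
    have "0 < \<alpha>" using lepskii_grid_ge[OF q a0 \<alpha>(1)] a0 by simp
    then have "Sigma_bound \<beta> p \<delta> \<le> Sigma_bound \<beta> \<alpha> \<delta>"
      using Sigma_bound_le[OF \<beta>, of \<delta> 1 \<alpha> p] \<delta> \<alpha> by simp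
    moreover have "norm (lavrentiev F xbar \<alpha> yd - lavrentiev F xbar p yd) \<le> e \<alpha> + e p"
      using norm_triangle_ineq4[of "lavrentiev F xbar \<alpha> yd - xdag" "lavrentiev F xbar p yd - xdag"]
      by (simp add: e_def)
    ultimately show ?thesis using near[OF \<alpha>] near[OF p(1)] by simp
  qed
  then have "p \<in> lepskii_set F xbar \<beta> q a0 \<delta> yd"
    using p by (auto simp: lepskii_set_def)
  then show ?thesis
    using near[OF p(1)] Sigma_bound_le[OF \<beta> _ q(1) A p(2)] \<delta> by (intro that) auto
qed

lemma alpha_Lep_near:
  assumes q: "0 < q" "q < 1" and a0: "0 < a0"
    and fin: "finite (lepskii_set F xbar \<beta> q a0 \<delta> yd)"
    and p: "p \<in> lepskii_set F xbar \<beta> q a0 \<delta> yd"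
  shows "norm (lavrentiev F xbar p yd - lavrentiev F xbar (alpha_Lep F xbar \<beta> q a0 \<delta> yd) yd)
    \<le> 2 * Sigma_bound \<beta> p \<delta>"
proof -
  let ?S = "lepskii_set F xbar \<beta> q a0 \<delta> yd"
  have "alpha_Lep F xbar \<beta> q a0 \<delta> yd \<in> ?S" "p \<le> alpha_Lep F xbar \<beta> q a0 \<delta> yd"
    using fin p by (auto simp: alpha_Lep_def intro: Max_in)
  moreover have "p \<in> lepskii_grid q a0" "a0 \<le> p"
    using p lepskii_grid_ge[OF q a0] by (auto simp: lepskii_set_def)
  ultimately show ?thesis unfolding lepskii_set_def by auto
qed

text \<open>The equation is tested with \<open>x - xbar\<close>, and \<open>F x\<close> is compared with \<open>F xbar\<close>.\<close>

lemma lavrentiev_near_reference: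
  fixes F :: "'a::{real_inner,complete_space} \<Rightarrow> 'a"
  assumes F: "hemicontinuous F" "monotone_operator F" and \<alpha>: "0 < \<alpha>"
  shows "norm (lavrentiev F xbar \<alpha> yd - xbar) \<le> norm (yd - F xbar) / \<alpha>"
proof -
  define x where "x = lavrentiev F xbar \<alpha> yd"
  have "\<alpha> *\<^sub>R (x - xbar) = (yd - F xbar) - (F x - F xbar)"
    using lavrentiev_equation[OF F \<alpha>, of xbar yd] by (simp add: x_def algebra_simps)
  then have "\<alpha> * inner (x - xbar) (x - xbar)
      = inner (yd - F xbar) (x - xbar) - inner (F x - F xbar) (x - xbar)"
    by (metis inner_diff_left inner_scaleR_left)
  also have "\<dots> \<le> inner (yd - F xbar) (x - xbar)"
    using F(2) by (simp add: monotone_operator_def)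
  also have "\<dots> \<le> norm (yd - F xbar) * norm (x - xbar)"
    by (rule norm_cauchy_schwarz)
  finally have "\<alpha> * norm (x - xbar) * norm (x - xbar) \<le> norm (yd - F xbar) * norm (x - xbar)"
    by (simp add: power2_norm_eq_inner[symmetric] power2_eq_square mult.assoc)
  then have "\<alpha> * norm (x - xbar) \<le> norm (yd - F xbar)"
    by (cases "x = xbar") (auto simp: mult_le_cancel_right)
  then show ?thesis using \<alpha> by (simp add: x_def le_divide_eq mult.commute)
qed

text \<open>As \<open>\<alpha>\<close> grows, the regularized solutions tend to the reference element \<open>xbar\<close>. If arbitrarily
  large grid points pass the test, the comparison at \<open>p\<close> survives in this limit.\<close>

lemma lepskii_set_infinite_near_reference:
  fixes F :: "'a::{real_inner,complete_space} \<Rightarrow> 'a"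
  assumes F: "hemicontinuous F" "monotone_operator F"
    and q: "0 < q" "q < 1" and a0: "0 < a0"
    and inf: "infinite (lepskii_set F xbar \<beta> q a0 \<delta> yd)"
    and p: "p \<in> lepskii_grid q a0"
  shows "norm (lavrentiev F xbar p yd - xbar) \<le> 2 * Sigma_bound \<beta> p \<delta>"
proof (rule field_le_epsilon)
  fix \<epsilon> :: real assume \<epsilon>: "0 < \<epsilon>"
  let ?S = "lepskii_set F xbar \<beta> q a0 \<delta> yd"
  define J where "J = {j. a0 / q ^ j \<in> ?S}"
  define B where "B = max p (norm (yd - F xbar) / \<epsilon>)"
  have "?S \<subseteq> (\<lambda>j. a0 / q ^ j) ` J" by (auto simp: J_def lepskii_set_def lepskii_grid_def)
  then have "infinite J" using inf finite_surj by blast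
  have "0 < B" using lepskii_grid_ge[OF q a0 p] a0 by (simp add: B_def less_max_iff_disj)
  then obtain n where n: "q ^ n < a0 / B" using real_arch_pow_inv[of "a0 / B" q] q a0 by auto
  obtain j where j: "n < j" "j \<in> J" using \<open>infinite J\<close> infinite_nat_iff_unbounded by blast
  define \<alpha> where "\<alpha> = a0 / q ^ j"
  have "q ^ j \<le> q ^ n" using q j by (intro power_decreasing) auto
  then have "q ^ j < a0 / B" using n by simp
  then have B: "B < \<alpha>" using q \<open>0 < B\<close> by (simp add: \<alpha>_def field_simps)
  have \<alpha>: "\<alpha> \<in> ?S" using j by (simp add: J_def \<alpha>_def)
  have "0 < \<alpha>" "p \<le> \<alpha>" "norm (yd - F xbar) / \<epsilon> \<le> \<alpha>" using B \<open>0 < B\<close> by (auto simp: B_def)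
  then have "norm (yd - F xbar) / \<alpha> \<le> \<epsilon>" using \<epsilon> by (simp add: field_simps)
  then have "norm (lavrentiev F xbar \<alpha> yd - xbar) \<le> \<epsilon>"
    using lavrentiev_near_reference[OF F \<open>0 < \<alpha>\<close>, of xbar yd] by linarith
  moreover have "norm (lavrentiev F xbar p yd - lavrentiev F xbar \<alpha> yd) \<le> 2 * Sigma_bound \<beta> p \<delta>"
    using \<alpha> p \<open>p \<le> \<alpha>\<close> lepskii_grid_ge[OF q a0 p] by (auto simp: lepskii_set_def)
  ultimately show "norm (lavrentiev F xbar p yd - xbar) \<le> 2 * Sigma_bound \<beta> p \<delta> + \<epsilon>"
    using norm_diff_triangle_le by fastforce
qed

text \<open>If infinitely many grid points passed the test, then \<open>xbar\<close>, as the limit of the regularized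
  solutions, would be as close to \<open>xdag\<close> as the error bound; for distinct \<open>xbar\<close> and \<open>xdag\<close> the
  smallness assumption excludes this. So the maximum exists, it is at least the comparison point
  \<open>p\<close>, and the test at \<open>p\<close> transfers the error bound from \<open>p\<close> to it.\<close>

lemma alpha_Lep_error:
  fixes F :: "'a::{real_inner,complete_space} \<Rightarrow> 'a" and xdag xbar yd :: 'a
  defines "e \<equiv> \<lambda>\<alpha>. norm (lavrentiev F xbar \<alpha> yd - xdag)"
  assumes F: "hemicontinuous F" "monotone_operator F"
    and q: "0 < q" "q < 1" and a0: "0 < a0" and A: "0 < A" and \<beta>: "\<beta> < 1" and \<delta>: "0 < \<delta>"
    and e0: "e a0 \<le> Sigma_bound \<beta> a0 \<delta>"
    and eA: "\<And>\<alpha>. \<alpha> \<in> lepskii_grid q a0 \<Longrightarrow> \<alpha> \<le> A \<Longrightarrow> e \<alpha> \<le> Sigma_bound \<beta> \<alpha> \<delta>"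
    and fin: "xdag = xbar \<Longrightarrow> finite (lepskii_set F xbar \<beta> q a0 \<delta> yd)"
    and small: "xdag \<noteq> xbar \<Longrightarrow> 3 * (Sigma_bound \<beta> A \<delta> / q) < norm (xdag - xbar)"
  shows "e (alpha_Lep F xbar \<beta> q a0 \<delta> yd) \<le> 3 * (Sigma_bound \<beta> A \<delta> / q)"
proof -
  let ?L = "alpha_Lep F xbar \<beta> q a0 \<delta> yd"
  obtain p where p: "p \<in> lepskii_set F xbar \<beta> q a0 \<delta> yd"
      "e p \<le> Sigma_bound \<beta> p \<delta>" "Sigma_bound \<beta> p \<delta> \<le> Sigma_bound \<beta> A \<delta> / q"
    using lepskii_set_contains_balanced_point[of q a0 A \<beta> \<delta> F xbar yd xdag]
      q a0 A \<beta> \<delta> e0 eA unfolding e_def by blast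
  have "finite (lepskii_set F xbar \<beta> q a0 \<delta> yd)"
  proof (rule ccontr)
    assume inf: "infinite (lepskii_set F xbar \<beta> q a0 \<delta> yd)"
    have "norm (lavrentiev F xbar p yd - xbar) \<le> 2 * Sigma_bound \<beta> p \<delta>"
      using p(1) by (intro lepskii_set_infinite_near_reference[OF F q a0 inf])
        (auto simp: lepskii_set_def)
    moreover have "norm (xdag - xbar) \<le> e p + norm (lavrentiev F xbar p yd - xbar)"
      using norm_triangle_ineq4[of "lavrentiev F xbar p yd - xbar" "lavrentiev F xbar p yd - xdag"]
      by (simp add: e_def)
    ultimately show False using p small fin inf by fastforce
  qed
  from alpha_Lep_near[OF q a0 this p(1)]
  have "norm (lavrentiev F xbar p yd - lavrentiev F xbar ?L yd) \<le> 2 * Sigma_bound \<beta> p \<delta>" .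
  moreover have "e ?L \<le> e p + norm (lavrentiev F xbar p yd - lavrentiev F xbar ?L yd)"
    using norm_triangle_ineq4[of "lavrentiev F xbar p yd - xdag"
        "lavrentiev F xbar p yd - lavrentiev F xbar ?L yd"]
    by (simp add: e_def)
  ultimately show ?thesis using p by simp
qed

section \<open>Convergence rates\<close>

theorem theorem5:
  fixes F :: "'a::{real_inner, complete_space} \<Rightarrow> 'a"
    and xdag xbar y :: 'a
    and M :: "'a set"
    and \<beta> :: real
    and \<phi> f G :: "real \<Rightarrow> real"
  assumes separable: "separable_space (euclidean :: 'a topology)"
    and infinite_dim: "\<not> (\<exists>B :: 'a set. finite B \<and> span B = UNIV)"
    and "hemicontinuous F" and "monotone_operator F"
    and "F xdag = y"
    and "0 \<le> \<beta>" and "\<beta> < 1"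
    and "index_function \<phi>"
    and variational_inequality:
      "\<And>x. x \<in> M \<Longrightarrow>
         inner (xdag - xbar) (xdag - x)
           \<le> \<beta> * (norm (x - xdag))\<^sup>2 + \<phi> (inner (F x - F xdag) (x - xdag))"
    and "Psi_construction \<phi> f G"
  shows
    \<comment> \<open>error estimate\<close>
    "(\<forall>\<alpha> \<delta> yd. \<alpha> > 0 \<and> inverse_integral_defined f \<alpha> \<and> \<delta> > 0 \<and> norm (y - yd) \<le> \<delta> \<and>
        lavrentiev F xbar \<alpha> yd \<in> M \<longrightarrow>
        (norm (lavrentiev F xbar \<alpha> yd - xdag))\<^sup>2
          \<le> 1 / (1 - \<beta>)\<^sup>2 * (\<delta>\<^sup>2 / \<alpha>\<^sup>2) + 2 / (1 - \<beta>) * Psi G \<alpha>)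
     \<and>
     \<comment> \<open>a priori choice\<close>
     ((\<forall>\<^sub>F (\<delta>, yd) in noise_to_0 y. lavrentiev F xbar (alpha_apri G \<delta>) yd \<in> M) \<longrightarrow>
        (\<lambda>(\<delta>, yd). norm (lavrentiev F xbar (alpha_apri G \<delta>) yd - xdag))
          \<in> O[noise_to_0 y](\<lambda>(\<delta>, yd). \<delta> / alpha_apri G \<delta>) \<and>
        O[noise_to_0 y](\<lambda>(\<delta>, yd). \<delta> / alpha_apri G \<delta>)
          = O[noise_to_0 y](\<lambda>(\<delta>, yd). sqrt (Psi G (alpha_apri G \<delta>))))
     \<and>
     \<comment> \<open>the special case with rate exponent one third\<close>
     (\<phi> \<in> \<Theta>[at_right 0](\<lambda>t. sqrt t) \<and> Psi G \<in> \<Theta>[at_right 0](\<lambda>t. t) \<longrightarrow>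
        alpha_apri G \<in> \<Theta>[at_right 0](\<lambda>\<delta>. \<delta> powr (2/3)) \<and>
        (\<forall>a :: real \<Rightarrow> real.
           (\<forall>\<^sub>F \<delta> in at_right 0. a \<delta> > 0) \<and> a \<in> \<Theta>[at_right 0](\<lambda>\<delta>. \<delta> powr (2/3)) \<and>
           (\<forall>\<^sub>F (\<delta>, yd) in noise_to_0 y. lavrentiev F xbar (a \<delta>) yd \<in> M) \<longrightarrow>
           (\<lambda>(\<delta>, yd). norm (lavrentiev F xbar (a \<delta>) yd - xdag))
             \<in> O[noise_to_0 y](\<lambda>(\<delta>, yd). \<delta> powr (1/3))))
     \<and>
     \<comment> \<open>no better rate function is possible\<close>
     (Liminf (at_right 0) (\<lambda>t. ereal (\<phi> t / sqrt t)) > 0 \<longrightarrow>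
        (\<exists>c>0. \<forall>\<^sub>F \<delta> in at_right 0. \<delta> / alpha_apri G \<delta> \<ge> c * \<delta> powr (1/3)))
     \<and>
     \<comment> \<open>Lepskii choice; only for \<open>xdag = xbar\<close> can the maximum fail to exist for small noise\<close>
     (\<forall>q \<alpha>0.
        0 < q \<and> q < 1 \<and>
        (\<forall>\<^sub>F (\<delta>, yd) in noise_to_0 y.
           \<alpha>0 \<delta> yd > 0 \<and>
           norm (lavrentiev F xbar (\<alpha>0 \<delta> yd) yd - xdag) \<le> Sigma_bound \<beta> (\<alpha>0 \<delta> yd) \<delta> \<and>
           (\<forall>\<alpha> \<in> lepskii_grid q (\<alpha>0 \<delta> yd).
              \<alpha> \<le> alpha_apri G \<delta> \<longrightarrow> lavrentiev F xbar \<alpha> yd \<in> M) \<and>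
           (xdag = xbar \<longrightarrow> finite (lepskii_set F xbar \<beta> q (\<alpha>0 \<delta> yd) \<delta> yd))) \<longrightarrow>
        (\<lambda>(\<delta>, yd).
           norm (lavrentiev F xbar (alpha_Lep F xbar \<beta> q (\<alpha>0 \<delta> yd) \<delta> yd) yd - xdag))
          \<in> O[noise_to_0 y](\<lambda>(\<delta>, yd). \<delta> / alpha_apri G \<delta>))"
proof -
  have f: "index_function f" and P: "index_function (Psi G)"
    using assms(10) by (auto simp: Psi_construction_def)
  let ?x = "\<lambda>\<alpha> yd. lavrentiev F xbar \<alpha> yd"
  have estimate: "(norm (?x \<alpha> yd - xdag))\<^sup>2
      \<le> 1 / (1 - \<beta>)\<^sup>2 * (\<delta>\<^sup>2 / \<alpha>\<^sup>2) + 2 / (1 - \<beta>) * Psi G \<alpha>"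
    if "0 < \<alpha>" "inverse_integral_defined f \<alpha>" "norm (y - yd) \<le> \<delta>" "?x \<alpha> yd \<in> M"
    for \<alpha> \<delta> yd
    using that assms(5)
    by (intro lavrentiev_error_estimate[OF assms(3,4,7,8,10)] variational_inequality) auto
  \<comment> \<open>Below a value of \<open>f\<close>, here \<open>f 1\<close>, the integral of the inverse exists and the error estimate
    applies.\<close>
  have defined: "\<forall>\<^sub>F \<delta> in at_right 0. alpha_apri G \<delta> \<le> f 1"
  proof -
    have "0 < f 1" using f by (simp add: index_function_def)
    then have "\<forall>\<^sub>F a in at_right 0. a \<le> f 1" by (intro eventually_at_rightI[of 0 "f 1"]) auto
    then show ?thesis by (rule eventually_compose_filterlim[OF _ filterlim_alpha_apri[OF P]])
  qed
  have below_apri: "norm (?x \<alpha> yd - xdag) \<le> Sigma_bound \<beta> \<alpha> \<delta>"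
    if "0 < \<alpha>" "\<alpha> \<le> alpha_apri G \<delta>" "alpha_apri G \<delta> \<le> f 1" "0 < \<delta>" "norm (y - yd) \<le> \<delta>"
      "?x \<alpha> yd \<in> M" for \<alpha> \<delta> yd
    using that
    by (intro error_le_Sigma_bound[OF P assms(7)] estimate inverse_integral_defined_small[OF f]) auto

  have part_apri: "(\<lambda>(\<delta>, yd). norm (?x (alpha_apri G \<delta>) yd - xdag))
      \<in> O[noise_to_0 y](\<lambda>(\<delta>, yd). \<delta> / alpha_apri G \<delta>)"
    if M: "\<forall>\<^sub>F (\<delta>, yd) in noise_to_0 y. ?x (alpha_apri G \<delta>) yd \<in> M"
  proof (rule bigoI)
    show "\<forall>\<^sub>F z in noise_to_0 y. norm (case z of (\<delta>, yd) \<Rightarrow> norm (?x (alpha_apri G \<delta>) yd - xdag))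
        \<le> sqrt (3 - 2 * \<beta>) / (1 - \<beta>) * norm (case z of (\<delta>, yd) \<Rightarrow> \<delta> / alpha_apri G \<delta>)"
      using M eventually_noise_data eventually_noise_level[OF defined]
    proof eventually_elim
      case (elim z)
      obtain \<delta> yd where z: "z = (\<delta>, yd)" by (cases z)
      have pos: "0 < \<delta>" "0 < alpha_apri G \<delta>" using elim alpha_apri_pos[OF P] by (auto simp: z)
      then have "norm (?x (alpha_apri G \<delta>) yd - xdag) \<le> Sigma_bound \<beta> (alpha_apri G \<delta>) \<delta>"
        using elim by (intro below_apri) (auto simp: z)
      then show ?case using pos by (simp add: z Sigma_bound_def)
    qed
  qed
  have part_rates: "O[noise_to_0 y](\<lambda>(\<delta>, yd). \<delta> / alpha_apri G \<delta>)
      = O[noise_to_0 y](\<lambda>(\<delta>, yd). sqrt (Psi G (alpha_apri G \<delta>)))"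
  proof (rule landau_o.big.cong)
    show "\<forall>\<^sub>F z in noise_to_0 y. (case z of (\<delta>, yd) \<Rightarrow> \<delta> / alpha_apri G \<delta>)
        = (case z of (\<delta>, yd) \<Rightarrow> sqrt (Psi G (alpha_apri G \<delta>)))"
      using eventually_noise_data
    proof eventually_elim
      case (elim z)
      obtain \<delta> yd where z: "z = (\<delta>, yd)" by (cases z)
      then have "0 < \<delta>" using elim by simp
      then show ?case
        using Psi_alpha_apri[OF P] alpha_apri_pos[OF P] by (simp add: z less_imp_le)
    qed
  qed

  have part_third: "(\<lambda>(\<delta>, yd). norm (?x (a \<delta>) yd - xdag))
      \<in> O[noise_to_0 y](\<lambda>(\<delta>, yd). \<delta> powr (1/3))"
    if lin: "Psi G \<in> \<Theta>[at_right 0](\<lambda>t. t)" and a0: "\<forall>\<^sub>F \<delta> in at_right 0. a \<delta> > 0"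
      and a: "a \<in> \<Theta>[at_right 0](\<lambda>\<delta>. \<delta> powr (2/3))"
      and M: "\<forall>\<^sub>F (\<delta>, yd) in noise_to_0 y. ?x (a \<delta>) yd \<in> M" for a :: "real \<Rightarrow> real"
  proof -
    from a obtain c d where c: "0 < c" "\<forall>\<^sub>F \<delta> in at_right 0. norm (a \<delta>) \<ge> c * norm (\<delta> powr (2/3))"
        and d: "0 < d" "\<forall>\<^sub>F \<delta> in at_right 0. norm (a \<delta>) \<le> d * norm (\<delta> powr (2/3))"
      by (auto simp: bigtheta_def elim!: landau_o.bigE landau_omega.bigE)
    from lin obtain l where l: "0 < l" "\<forall>\<^sub>F t in at_right 0. norm (Psi G t) \<le> l * norm t"
      by (auto simp: bigtheta_def elim!: landau_o.bigE)
    have "((\<lambda>\<delta>::real. \<delta> powr (2/3)) \<longlongrightarrow> 0) (at_right 0)"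
      by (rule tendsto_zero_powrI[OF tendsto_ident_at tendsto_const])
        (auto simp: eventually_at_filter)
    then have "((\<lambda>\<delta>::real. d * norm (\<delta> powr (2/3))) \<longlongrightarrow> 0) (at_right 0)"
      by (intro tendsto_mult_right_zero tendsto_norm_zero)
    from Lim_null_comparison[OF d(2) this]
    have a_lim: "filterlim a (at_right 0) (at_right 0)"
      using a0 by (auto simp: filterlim_at elim: eventually_mono)
    have level: "\<forall>\<^sub>F \<delta> in at_right 0. 0 < a \<delta> \<and> c * \<delta> powr (2/3) \<le> a \<delta> \<and> a \<delta> \<le> d * \<delta> powr (2/3) \<and>
        Psi G (a \<delta>) \<le> l * a \<delta> \<and> inverse_integral_defined f (a \<delta>)"
      using a0 c(2) d(2) eventually_compose_filterlim[OF l(2) a_lim]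
        eventually_compose_filterlim[OF eventually_inverse_integral_defined[OF f] a_lim]
      by eventually_elim auto
    show ?thesis
    proof (rule bigoI)
      let ?C = "sqrt (1 / (1 - \<beta>)\<^sup>2 / c\<^sup>2 + 2 / (1 - \<beta>) * l * d)"
      show "\<forall>\<^sub>F z in noise_to_0 y. norm (case z of (\<delta>, yd) \<Rightarrow> norm (?x (a \<delta>) yd - xdag))
          \<le> ?C * norm (case z of (\<delta>, yd) \<Rightarrow> \<delta> powr (1/3))"
        using M eventually_noise_data eventually_noise_level[OF level]
      proof eventually_elim
        case (elim z)
        obtain \<delta> yd where z: "z = (\<delta>, yd)" by (cases z)
        have "2 / (1 - \<beta>) * Psi G (a \<delta>) \<le> 2 / (1 - \<beta>) * (l * a \<delta>)"
          using elim assms(7) by (intro mult_left_mono) (auto simp: z)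
        moreover have "(norm (?x (a \<delta>) yd - xdag))\<^sup>2
            \<le> 1 / (1 - \<beta>)\<^sup>2 * (\<delta>\<^sup>2 / (a \<delta>)\<^sup>2) + 2 / (1 - \<beta>) * Psi G (a \<delta>)"
          using elim by (intro estimate) (auto simp: z)
        ultimately have "(norm (?x (a \<delta>) yd - xdag))\<^sup>2
            \<le> 1 / (1 - \<beta>)\<^sup>2 * (\<delta>\<^sup>2 / (a \<delta>)\<^sup>2) + 2 / (1 - \<beta>) * l * a \<delta>"
          by (simp only: mult.assoc)
        then have "\<bar>norm (?x (a \<delta>) yd - xdag)\<bar> \<le> ?C * \<delta> powr (1/3)"
          using elim assms(7) c(1) l(1) by (intro one_third_rate) (auto simp: z)
        then show ?case by (simp add: z)
      qed
    qed
  qed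

  have part_best: "\<exists>c>0. \<forall>\<^sub>F \<delta> in at_right 0. \<delta> / alpha_apri G \<delta> \<ge> c * \<delta> powr (1/3)"
    if liminf: "Liminf (at_right 0) (\<lambda>t. ereal (\<phi> t / sqrt t)) > 0"
  proof -
    obtain c where c: "0 < ereal c" "ereal c < Liminf (at_right 0) (\<lambda>t. ereal (\<phi> t / sqrt t))"
      using ereal_dense2[OF liminf] by blast
    have "\<forall>\<^sub>F t in at_right 0. c * sqrt t \<le> \<phi> t"
      using less_LiminfD[OF c(2)] eventually_at_right_less[of 0]
      by eventually_elim (simp add: field_simps)
    then have "\<forall>\<^sub>F a in at_right 0. c\<^sup>2 / 4 * a \<le> Psi G a"
      using c(1) by (intro Psi_lower_bound[OF assms(8,10)]) auto
    from rate_lower_bound[OF P _ this] show ?thesis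
      using c(1) by (intro exI[of _ "root 3 (c\<^sup>2 / 4)"]) simp
  qed

  have part_lepskii: "(\<lambda>(\<delta>, yd). norm (?x (alpha_Lep F xbar \<beta> q (\<alpha>0 \<delta> yd) \<delta> yd) yd - xdag))
      \<in> O[noise_to_0 y](\<lambda>(\<delta>, yd). \<delta> / alpha_apri G \<delta>)"
    if q: "0 < q" "q < 1"
      and start: "\<forall>\<^sub>F (\<delta>, yd) in noise_to_0 y.
           \<alpha>0 \<delta> yd > 0 \<and>
           norm (?x (\<alpha>0 \<delta> yd) yd - xdag) \<le> Sigma_bound \<beta> (\<alpha>0 \<delta> yd) \<delta> \<and>
           (\<forall>\<alpha> \<in> lepskii_grid q (\<alpha>0 \<delta> yd). \<alpha> \<le> alpha_apri G \<delta> \<longrightarrow> ?x \<alpha> yd \<in> M) \<and>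
           (xdag = xbar \<longrightarrow> finite (lepskii_set F xbar \<beta> q (\<alpha>0 \<delta> yd) \<delta> yd))"
    for q and \<alpha>0 :: "real \<Rightarrow> 'a \<Rightarrow> real"
  proof (rule bigoI)
    let ?C = "3 * (sqrt (3 - 2 * \<beta>) / (1 - \<beta>) / q)"
    have C: "3 * (Sigma_bound \<beta> A \<delta> / q) = ?C * (\<delta> / A)" for A \<delta>
      by (simp add: Sigma_bound_def mult_ac)
    have "((\<lambda>\<delta>. ?C * (\<delta> / alpha_apri G \<delta>)) \<longlongrightarrow> ?C * 0) (at_right 0)"
      by (intro tendsto_mult tendsto_const rate_tendsto_0[OF P])
    then have lim: "((\<lambda>\<delta>. ?C * (\<delta> / alpha_apri G \<delta>)) \<longlongrightarrow> 0) (at_right 0)" by simp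
    \<comment> \<open>The error bound tends to 0, so it finally falls below the distance of \<open>xdag\<close> from \<open>xbar\<close> and
      the Lepskii set is finite.\<close>
    have small: "\<forall>\<^sub>F \<delta> in at_right 0. xdag \<noteq> xbar \<longrightarrow>
        ?C * (\<delta> / alpha_apri G \<delta>) < norm (xdag - xbar)"
    proof (cases "xdag = xbar")
      case False
      then have "0 < norm (xdag - xbar)" by simp
      from order_tendstoD(2)[OF lim this] show ?thesis by (rule eventually_mono) simp
    qed simp
    show "\<forall>\<^sub>F z in noise_to_0 y. norm (case z of (\<delta>, yd) \<Rightarrow>
          norm (?x (alpha_Lep F xbar \<beta> q (\<alpha>0 \<delta> yd) \<delta> yd) yd - xdag))
        \<le> ?C * norm (case z of (\<delta>, yd) \<Rightarrow> \<delta> / alpha_apri G \<delta>)"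
      using start eventually_noise_data eventually_noise_level[OF small]
        eventually_noise_level[OF defined]
    proof eventually_elim
      case (elim z)
      obtain \<delta> yd where z: "z = (\<delta>, yd)" by (cases z)
      have pos: "0 < \<delta>" "0 < alpha_apri G \<delta>" using elim alpha_apri_pos[OF P] by (auto simp: z)
      have grid: "norm (?x \<alpha> yd - xdag) \<le> Sigma_bound \<beta> \<alpha> \<delta>"
        if "\<alpha> \<in> lepskii_grid q (\<alpha>0 \<delta> yd)" "\<alpha> \<le> alpha_apri G \<delta>" for \<alpha>
        using that elim lepskii_grid_ge[OF q _ that(1)]
        by (intro below_apri) (auto simp: z)
      have "norm (?x (alpha_Lep F xbar \<beta> q (\<alpha>0 \<delta> yd) \<delta> yd) yd - xdag)
          \<le> 3 * (Sigma_bound \<beta> (alpha_apri G \<delta>) \<delta> / q)"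
      proof (rule alpha_Lep_error[OF assms(3,4) q])
        show "3 * (Sigma_bound \<beta> (alpha_apri G \<delta>) \<delta> / q) < norm (xdag - xbar)"
          if "xdag \<noteq> xbar"
          unfolding C using elim that by (simp add: z)
      qed (use elim pos grid assms(7) in \<open>auto simp: z\<close>)
      then show ?case using pos unfolding C by (simp add: z)
    qed
  qed
  show ?thesis
    by (intro conjI allI impI; (elim conjE)?;
        (rule estimate part_apri part_rates alpha_apri_bigtheta[OF P] part_third part_best
          part_lepskii; assumption))
qed

end
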